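(* Let $L/K$ be a finite separable extension of local or global fields (of arbitrary characteristic), and let $H_1,H_2$ be two Hopf algebras giving Hopf-Galois structures on $L/K$ whose actions on $L$ commute, i.e. $h_1\cdot(h_2\cdot x) = h_2\cdot(h_1\cdot x)$ for all $h_1\in H_1$, $h_2\in H_2$, $x\in L$. Let $\mathfrak B$ be a fractional ideal of $L$, and let $\mathfrak A_1,\mathfrak A_2$ be the associated orders of $\mathfrak B$ in $H_1,H_2$ respectively. Then $\mathfrak B$ is a free $\mathfrak A_1$-module if and only if it is a free $\mathfrak A_2$-module.
   Context: A Hopf-Galois structure on $L/K$ is a $K$-Hopf algebra $H$ together with an action of $H$ on $L$ making $L$ an $H$-module algebra such that the natural map $L\otimes_K H\to \mathrm{End}_K(L)$ is a bijection. For such $H$ and a fractional ideal $\mathfrak B$ of $L$, the associated order of $\mathfrak B$ in $H$ is $\mathfrak A_H(\mathfrak B)=\{h\in H : h\cdot x\in\mathfrak B \text{ for all } x\in\mathfrak B\}$, an $\mathfrak O_K$-order in $H$, where $\mathfrak O_K$ is the ring of integers of $K$. *)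

theory Defs
  imports
    "HOL-Library.Multiset"
    "HOL-Computational_Algebra.Computational_Algebra"
    "Jordan_Normal_Form.Ring_Hom_Matrix"
begin

text \<open>Fields are types; an extension \<open>L/K\<close> is a field homomorphism \<open>\<iota>\<close> from \<open>K\<close> to \<open>L\<close>.\<close>

definition ext_scale :: "('k::field \<Rightarrow> 'l::field) \<Rightarrow> 'k \<Rightarrow> 'l \<Rightarrow> 'l" where
  "ext_scale \<iota> c x = \<iota> c * x"

definition finite_over :: "'a::field set \<Rightarrow> bool" where
  "finite_over F \<longleftrightarrow>
     (\<exists>B. finite B \<and> (\<forall>x. \<exists>c. (\<forall>b\<in>B. c b \<in> F) \<and> x = (\<Sum>b\<in>B. c b * b)))"

text \<open>Separability: the minimal polynomial of every element is prime to its derivative,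
  i.e. has only simple roots in every extension field.\<close>

definition finite_separable_extension :: "('k::field \<Rightarrow> 'l::field) \<Rightarrow> bool" where
  "finite_separable_extension \<iota> \<longleftrightarrow>
     field_hom \<iota> \<and> finite_over (range \<iota>) \<and>
     (\<forall>x. \<exists>p. irreducible p \<and> poly (map_poly \<iota> p) x = 0 \<and> coprime p (pderiv p))"


subsection \<open>Rings of integers of local and global fields\<close>

definition integral_closure :: "'a::field set \<Rightarrow> 'a set" where
  "integral_closure A =
     {x. \<exists>p. lead_coeff p = 1 \<and> (\<forall>i. coeff p i \<in> A) \<and> poly p x = 0}"

definition fractions :: "'a::field set \<Rightarrow> 'a set" where
  "fractions A = {x / y | x y. x \<in> A \<and> y \<in> A \<and> y \<noteq> 0}"

text \<open>The value of a valuation at \<open>0\<close>, mathematically \<open>\<infinity>\<close>, is left unspecified,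
  and every use of \<open>v\<close> is guarded accordingly.\<close>

definition normalized_discrete_valuation :: "('k::field \<Rightarrow> int) \<Rightarrow> bool" where
  "normalized_discrete_valuation v \<longleftrightarrow>
     (\<forall>x y. x \<noteq> 0 \<longrightarrow> y \<noteq> 0 \<longrightarrow> v (x * y) = v x + v y) \<and>
     (\<forall>x y. x \<noteq> 0 \<longrightarrow> y \<noteq> 0 \<longrightarrow> x + y \<noteq> 0 \<longrightarrow> min (v x) (v y) \<le> v (x + y)) \<and>
     (\<exists>x. x \<noteq> 0 \<and> v x = 1)"

definition val_ge :: "('k::field \<Rightarrow> int) \<Rightarrow> int \<Rightarrow> 'k set" where
  "val_ge v n = {x. x = 0 \<or> n \<le> v x}"

definition valuation_complete :: "('k::field \<Rightarrow> int) \<Rightarrow> bool" where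
  "valuation_complete v \<longleftrightarrow>
     (\<forall>X::nat \<Rightarrow> 'k.
        (\<forall>n. \<exists>M. \<forall>i\<ge>M. \<forall>j\<ge>M. X i - X j \<in> val_ge v n) \<longrightarrow>
        (\<exists>l. \<forall>n. \<exists>M. \<forall>i\<ge>M. X i - l \<in> val_ge v n))"

text \<open>Local fields are the non-archimedean ones: complete with respect to a discrete valuation
  with finite residue field.\<close>

definition local_field_valuation :: "('k::field \<Rightarrow> int) \<Rightarrow> bool" where
  "local_field_valuation v \<longleftrightarrow>
     normalized_discrete_valuation v \<and> valuation_complete v \<and>
     finite (val_ge v 0 // {(x, y). x \<in> val_ge v 0 \<and> y \<in> val_ge v 0 \<and> x - y \<in> val_ge v 1})"

text \<open>\<open>\<int>\<close> is the image of the integers, which is the prime field \<open>F\<^sub>p\<close> in characteristic \<open>p\<close>.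
  Thus \<open>prime_poly_ring t\<close> is \<open>F\<^sub>p[t]\<close> there. A field is finite over \<open>F\<^sub>q(t)\<close> iff it is finite over
  \<open>F\<^sub>p(t)\<close>, and \<open>F\<^sub>q[t]\<close> and \<open>F\<^sub>p[t]\<close> have the same integral closure.\<close>

definition prime_poly_ring :: "'k::field \<Rightarrow> 'k set" where
  "prime_poly_ring t = {poly f t | f. \<forall>i. coeff f i \<in> \<int>}"

definition transcendental_over_prime_field :: "'k::field \<Rightarrow> bool" where
  "transcendental_over_prime_field t \<longleftrightarrow> (\<forall>f. (\<forall>i. coeff f i \<in> \<int>) \<and> poly f t = 0 \<longrightarrow> f = 0)"

text \<open>\<open>ring_of_integers OK\<close>: the field \<open>'k\<close> is a local or global field and \<open>OK\<close> is its ring of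
  integers. For a global function field the ring of integers depends on the choice of the places
  at infinity, equivalently of a coordinate \<open>t\<close>; all choices are admitted.\<close>

definition ring_of_integers :: "'k::field set \<Rightarrow> bool" where
  "ring_of_integers OK \<longleftrightarrow>
     (\<exists>v. local_field_valuation v \<and> OK = val_ge v 0) \<or>
     (CHAR('k) = 0 \<and> finite_over (fractions (\<int> :: 'k set)) \<and> OK = integral_closure \<int>) \<or>
     (CHAR('k) > 0 \<and>
        (\<exists>t. transcendental_over_prime_field t \<and> finite_over (fractions (prime_poly_ring t)) \<and>
             OK = integral_closure (prime_poly_ring t)))"

definition fractional_ideal :: "'l::field set \<Rightarrow> 'l set \<Rightarrow> bool" where
  "fractional_ideal R I \<longleftrightarrow>
     0 \<in> I \<and> I \<noteq> {0} \<and>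
     (\<forall>x\<in>I. \<forall>y\<in>I. x + y \<in> I) \<and> (\<forall>r\<in>R. \<forall>x\<in>I. r * x \<in> I) \<and>
     (\<exists>d\<in>R. d \<noteq> 0 \<and> (\<forall>x\<in>I. d * x \<in> R))"


subsection \<open>Tensor products\<close>

text \<open>A multiset \<open>{#(a\<^sub>1, b\<^sub>1), \<dots>, (a\<^sub>n, b\<^sub>n)#}\<close> stands for the sum of the \<open>a\<^sub>i \<otimes> b\<^sub>i\<close>. The tensor product is
  the free commutative monoid on pairs modulo the congruence generated by biadditivity and
  balancedness; the \<open>zero\<close> rules make the quotient a group, since \<open>(a, b) + (- a, b)\<close> becomes zero.\<close>

inductive tensor_eq ::
    "('k \<Rightarrow> 'a::ab_group_add \<Rightarrow> 'a) \<Rightarrow> ('k \<Rightarrow> 'b::ab_group_add \<Rightarrow> 'b) \<Rightarrow>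
     ('a \<times> 'b) multiset \<Rightarrow> ('a \<times> 'b) multiset \<Rightarrow> bool"
  for sA sB where
  refl: "tensor_eq sA sB s s"
| sym: "tensor_eq sA sB s t \<Longrightarrow> tensor_eq sA sB t s"
| trans: "tensor_eq sA sB s t \<Longrightarrow> tensor_eq sA sB t u \<Longrightarrow> tensor_eq sA sB s u"
| cong: "tensor_eq sA sB s t \<Longrightarrow> tensor_eq sA sB (s + u) (t + u)"
| add_left: "tensor_eq sA sB {#(a + a', b)#} {#(a, b), (a', b)#}"
| add_right: "tensor_eq sA sB {#(a, b + b')#} {#(a, b), (a, b')#}"
| balanced: "tensor_eq sA sB {#(sA c a, b)#} {#(a, sB c b)#}"
| zero_left: "tensor_eq sA sB {#(0, b)#} {#}"
| zero_right: "tensor_eq sA sB {#(a, 0)#} {#}"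

inductive tensor3_eq ::
    "('k \<Rightarrow> 'a::ab_group_add \<Rightarrow> 'a) \<Rightarrow> ('a \<times> 'a \<times> 'a) multiset \<Rightarrow> ('a \<times> 'a \<times> 'a) multiset \<Rightarrow> bool"
  for sA where
  refl: "tensor3_eq sA s s"
| sym: "tensor3_eq sA s t \<Longrightarrow> tensor3_eq sA t s"
| trans: "tensor3_eq sA s t \<Longrightarrow> tensor3_eq sA t u \<Longrightarrow> tensor3_eq sA s u"
| cong: "tensor3_eq sA s t \<Longrightarrow> tensor3_eq sA (s + u) (t + u)"
| add1: "tensor3_eq sA {#(a + a', b, c)#} {#(a, b, c), (a', b, c)#}"
| add2: "tensor3_eq sA {#(a, b + b', c)#} {#(a, b, c), (a, b', c)#}"
| add3: "tensor3_eq sA {#(a, b, c + c')#} {#(a, b, c), (a, b, c')#}"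
| balanced12: "tensor3_eq sA {#(sA r a, b, c)#} {#(a, sA r b, c)#}"
| balanced23: "tensor3_eq sA {#(a, sA r b, c)#} {#(a, b, sA r c)#}"
| zero1: "tensor3_eq sA {#(0, b, c)#} {#}"
| zero2: "tensor3_eq sA {#(a, 0, c)#} {#}"
| zero3: "tensor3_eq sA {#(a, b, 0)#} {#}"

definition tensor_product ::
    "('k \<Rightarrow> 'a::ab_group_add \<Rightarrow> 'a) \<Rightarrow> ('k \<Rightarrow> 'b::ab_group_add \<Rightarrow> 'b) \<Rightarrow> ('a \<times> 'b) multiset set set"
  where "tensor_product sA sB = UNIV // {(s, t). tensor_eq sA sB s t}"


subsection \<open>Hopf algebras and Hopf-Galois structures\<close>

text \<open>\<open>comult h\<close> is a chosen representative of the comultiplication of \<open>h\<close> in \<open>H \<otimes> H\<close>, so that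
  \<open>\<Sum>(a, b)\<in>#comult h\<close> is the Sweedler sum over \<open>h\<^sub>(\<^sub>1\<^sub>) \<otimes> h\<^sub>(\<^sub>2\<^sub>)\<close>. Every identity between tensors is
  imposed only up to \<open>tensor_eq\<close> or \<open>tensor3_eq\<close>, hence does not depend on the representatives.\<close>

locale hopf_algebra = vector_space scale
  for scale :: "'k::field \<Rightarrow> 'h::ring_1 \<Rightarrow> 'h" +
  fixes comult :: "'h \<Rightarrow> ('h \<times> 'h) multiset"
    and counit :: "'h \<Rightarrow> 'k"
    and antipode :: "'h \<Rightarrow> 'h"
  assumes scale_mult_left: "scale c g * h = scale c (g * h)"
    and scale_mult_right: "g * scale c h = scale c (g * h)"
    and comult_add: "tensor_eq scale scale (comult (g + h)) (comult g + comult h)"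
    and comult_scale:
      "tensor_eq scale scale (comult (scale c h)) {#(scale c a, b). (a, b) \<in># comult h#}"
    and comult_one: "tensor_eq scale scale (comult 1) {#(1, 1)#}"
    and comult_mult:
      "tensor_eq scale scale (comult (g * h))
         (\<Sum>(a, b)\<in>#comult g. {#(a * c, b * d). (c, d) \<in># comult h#})"
    and counit_add: "counit (g + h) = counit g + counit h"
    and counit_scale: "counit (scale c h) = c * counit h"
    and counit_one: "counit 1 = 1"
    and counit_mult: "counit (g * h) = counit g * counit h"
    and coassoc:
      "tensor3_eq scale
         (\<Sum>(a, b)\<in>#comult h. {#(a1, a2, b). (a1, a2) \<in># comult a#})
         (\<Sum>(a, b)\<in>#comult h. {#(a, b1, b2). (b1, b2) \<in># comult b#})"
    and counit_left: "(\<Sum>(a, b)\<in>#comult h. scale (counit a) b) = h"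
    and counit_right: "(\<Sum>(a, b)\<in>#comult h. scale (counit b) a) = h"
    and antipode_add: "antipode (g + h) = antipode g + antipode h"
    and antipode_scale: "antipode (scale c h) = scale c (antipode h)"
    and antipode_left: "(\<Sum>(a, b)\<in>#comult h. antipode a * b) = scale (counit h) 1"
    and antipode_right: "(\<Sum>(a, b)\<in>#comult h. a * antipode b) = scale (counit h) 1"

definition galois_map :: "('h \<Rightarrow> 'l::field \<Rightarrow> 'l) \<Rightarrow> ('l \<times> 'h) multiset \<Rightarrow> 'l \<Rightarrow> 'l" where
  "galois_map act s = (\<lambda>y. \<Sum>(x, h)\<in>#s. x * act h y)"

text \<open>In \<open>galois_bij\<close>, \<open>the_elem (galois_map act ` T)\<close> is the value on the class \<open>T\<close> of the map induced
  on \<open>L \<otimes>\<^sub>K H\<close> by \<open>galois_map act\<close>, which is constant on classes by linearity of the action.\<close>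

locale hopf_galois_structure = hopf_algebra scale comult counit antipode
  for \<iota> :: "'k::field \<Rightarrow> 'l::field"
    and scale :: "'k \<Rightarrow> 'h::ring_1 \<Rightarrow> 'h"
    and comult counit antipode +
  fixes act :: "'h \<Rightarrow> 'l \<Rightarrow> 'l"
  assumes act_add_left: "act (g + h) x = act g x + act h x"
    and act_scale_left: "act (scale c h) x = \<iota> c * act h x"
    and act_linear: "Vector_Spaces.linear (ext_scale \<iota>) (ext_scale \<iota>) (act h)"
    and act_one: "act 1 x = x"
    and act_mult: "act (g * h) x = act g (act h x)"
    and act_unit: "act h 1 = \<iota> (counit h)"
    and act_prod: "act h (x * y) = (\<Sum>(a, b)\<in>#comult h. act a x * act b y)"
    and galois_bij:
      "bij_betw (\<lambda>T. the_elem (galois_map act ` T))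
         (tensor_product (ext_scale \<iota>) scale)
         {f. Vector_Spaces.linear (ext_scale \<iota>) (ext_scale \<iota>) f}"

definition associated_order :: "('h \<Rightarrow> 'l \<Rightarrow> 'l) \<Rightarrow> 'l set \<Rightarrow> 'h set" where
  "associated_order act B = {h. \<forall>x\<in>B. act h x \<in> B}"

text \<open>\<open>B\<close> is free over the subring \<open>A\<close> of \<open>'h\<close>: it has a basis \<open>X\<close>, of arbitrary cardinality.\<close>

definition free_module :: "'h::ring_1 set \<Rightarrow> ('h \<Rightarrow> 'l::ab_group_add \<Rightarrow> 'l) \<Rightarrow> 'l set \<Rightarrow> bool" where
  "free_module A act B \<longleftrightarrow>
     (\<exists>X\<subseteq>B. \<forall>b\<in>B. \<exists>!c. range c \<subseteq> A \<and> (\<forall>x. x \<notin> X \<longrightarrow> c x = 0) \<and> finite {x. c x \<noteq> 0} \<and>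
        b = (\<Sum>x | c x \<noteq> 0. act (c x) x))"

end

theory Submission
  imports
    Defs
    "HOL-Library.Function_Algebras"
    "HOL-Algebra.Algebraic_Closure_Type"
    "Jordan_Normal_Form.Char_Poly"
begin

text \<open>If \<open>B\<close> has an \<open>A\<^sub>1\<close>-basis \<open>X\<close> and \<open>x \<in> X\<close>, then \<open>h \<mapsto> h \<cdot> x\<close> is injective on \<open>H\<^sub>1\<close>, because every
  \<open>h \<in> H\<^sub>1\<close> has a nonzero multiple in \<open>A\<^sub>1\<close>. Since \<open>dim H\<^sub>1 = [L:K]\<close> this map is bijective, which
  forces \<open>X = {x}\<close> and \<open>B = A\<^sub>1 \<cdot> x\<close>. If \<open>h \<in> H\<^sub>2\<close> kills \<open>x\<close> then it kills \<open>H\<^sub>1 \<cdot> x = L\<close>, so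
  \<open>h \<mapsto> h \<cdot> x\<close> is bijective on \<open>H\<^sub>2\<close> as well, and \<open>h \<cdot> x \<in> B\<close> implies
  \<open>h \<cdot> B = h A\<^sub>1 \<cdot> x = A\<^sub>1 \<cdot> (h \<cdot> x) \<subseteq> B\<close>, i.e. \<open>h \<in> A\<^sub>2\<close>. Hence \<open>x\<close> is an \<open>A\<^sub>2\<close>-basis of \<open>B\<close>.

  That \<open>A\<^sub>1\<close> spans \<open>H\<^sub>1\<close> needs the integral closure of \<open>O\<^sub>K\<close> to be contained in a lattice. As the
  \<open>K\<close>-linear functionals on \<open>L\<close> form a one-dimensional \<open>L\<close>-space, one nonzero functional that maps
  integral elements into \<open>O\<^sub>K\<close> suffices; it is built along a tower of simple extensions.\<close>

hide_const (open) up_ring.coeff up_ring.monom Polynomials.degree Polynomials.lead_coeff Module.smult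
no_notation fps_nth (infixl "$" 75)

subsection \<open>Integral closures\<close>

definition unital_subring :: "'a::comm_ring_1 set \<Rightarrow> bool" where
  "unital_subring R \<longleftrightarrow> 1 \<in> R \<and> (\<forall>x\<in>R. \<forall>y\<in>R. x - y \<in> R \<and> x * y \<in> R)"

definition polys_over :: "'a::comm_ring_1 set \<Rightarrow> 'a poly set" where
  "polys_over R = {p. \<forall>i. coeff p i \<in> R}"

lemma unital_subringI:
  assumes "1 \<in> R" "\<And>x y. x \<in> R \<Longrightarrow> y \<in> R \<Longrightarrow> x - y \<in> R" "\<And>x y. x \<in> R \<Longrightarrow> y \<in> R \<Longrightarrow> x * y \<in> R"
  shows "unital_subring R"
  using assms by (auto simp: unital_subring_def)

context
  fixes R :: "'a::comm_ring_1 set"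
  assumes R: "unital_subring R"
begin

lemma subring_one: "1 \<in> R"
  and subring_diff: "x \<in> R \<Longrightarrow> y \<in> R \<Longrightarrow> x - y \<in> R"
  and subring_mult: "x \<in> R \<Longrightarrow> y \<in> R \<Longrightarrow> x * y \<in> R"
  using R by (auto simp: unital_subring_def)

lemma subring_zero: "0 \<in> R"
  using subring_diff[OF subring_one subring_one] by simp

lemma subring_uminus: "x \<in> R \<Longrightarrow> - x \<in> R"
  using subring_diff[OF subring_zero] by force

lemma subring_add: "x \<in> R \<Longrightarrow> y \<in> R \<Longrightarrow> x + y \<in> R"
  using subring_diff[of x "- y"] subring_uminus by simp

lemma subring_power: "x \<in> R \<Longrightarrow> x ^ n \<in> R"
  by (induction n) (auto intro: subring_one subring_mult)

lemma subring_of_nat: "of_nat n \<in> R"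
  by (induction n) (auto intro: subring_zero subring_one subring_add)

lemma subring_sum: "(\<And>i. i \<in> I \<Longrightarrow> f i \<in> R) \<Longrightarrow> sum f I \<in> R"
  by (induction I rule: infinite_finite_induct) (auto intro: subring_zero subring_add)

lemma subring_prod: "(\<And>i. i \<in> I \<Longrightarrow> f i \<in> R) \<Longrightarrow> prod f I \<in> R"
  by (induction I rule: infinite_finite_induct) (auto intro: subring_one subring_mult)

lemmas subring_intros = subring_zero subring_one subring_uminus subring_add subring_diff
  subring_mult subring_power subring_sum subring_prod

lemma polys_over_const: "a \<in> R \<Longrightarrow> [:a:] \<in> polys_over R"
  by (auto simp: polys_over_def coeff_pCons subring_zero split: nat.splits)

lemma polys_over_pCons: "pCons a p \<in> polys_over R \<longleftrightarrow> a \<in> R \<and> p \<in> polys_over R"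
proof -
  have "(\<forall>i. coeff (pCons a p) i \<in> R) \<longleftrightarrow> a \<in> R \<and> (\<forall>i. coeff p i \<in> R)"
    by (metis coeff_pCons_0 coeff_pCons_Suc not0_implies_Suc)
  then show ?thesis by (simp add: polys_over_def)
qed

lemma polys_over_zero: "0 \<in> polys_over R"
  by (simp add: polys_over_def subring_zero)

lemma polys_over_X: "[:0, 1:] \<in> polys_over R"
  by (simp add: polys_over_pCons polys_over_zero subring_intros)

lemma polys_over_monom: "a \<in> R \<Longrightarrow> monom a n \<in> polys_over R"
  by (simp add: polys_over_def subring_zero)

lemma unital_subring_polys_over: "unital_subring (polys_over R)"
  by (rule unital_subringI)
    (auto simp: polys_over_def coeff_1 coeff_mult intro!: subring_intros)

lemma polys_over_smult: "a \<in> R \<Longrightarrow> p \<in> polys_over R \<Longrightarrow> smult a p \<in> polys_over R"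
  by (auto simp: polys_over_def intro: subring_mult)

lemma poly_in_subring: "p \<in> polys_over R \<Longrightarrow> x \<in> R \<Longrightarrow> poly p x \<in> R"
  by (auto simp: polys_over_def poly_altdef intro!: subring_sum subring_mult subring_power)

text \<open>The Leibniz formula builds the determinant from entries and signs by sums and products.
  It also applies to the subring \<open>polys_over R\<close>, which is how characteristic
  polynomials are treated.\<close>

lemma det_in_subring:
  assumes "A \<in> carrier_mat n n" "\<And>i j. i < n \<Longrightarrow> j < n \<Longrightarrow> A $$ (i, j) \<in> R"
  shows "det A \<in> R"
proof -
  have "(of_int (sign p) :: 'a) \<in> R" for p :: "nat \<Rightarrow> nat"
    by (auto simp: sign_def intro: subring_one subring_uminus)
  then show ?thesis
    unfolding det_def using assms
    by (auto simp: permutes_in_image intro!: subring_zero subring_sum subring_mult subring_prod)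
qed

end

lemmas polys_over_intros = subring_intros[OF unital_subring_polys_over]

lemma pcompose_in_polys_over:
  assumes "unital_subring R" "p \<in> polys_over R" "q \<in> polys_over R"
  shows "pcompose p q \<in> polys_over R"
  using assms(2)
proof (induction p)
  case 0
  then show ?case by (simp add: polys_over_zero assms)
next
  case (pCons a p)
  then show ?case
    using assms by (auto simp: pcompose_pCons polys_over_pCons
        intro!: polys_over_intros polys_over_const)
qed

lemma char_poly_in_polys_over:
  assumes R: "unital_subring R" and A: "A \<in> carrier_mat n n"
    and "\<And>i j. i < n \<Longrightarrow> j < n \<Longrightarrow> A $$ (i, j) \<in> R"
  shows "char_poly A \<in> polys_over R"
  unfolding char_poly_def
proof (rule det_in_subring[OF unital_subring_polys_over[OF R]])
  show "char_poly_matrix A \<in> carrier_mat n n" using A by simp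
  fix i j assume "i < n" "j < n"
  then show "char_poly_matrix A $$ (i, j) \<in> polys_over R"
    using A assms(3) subring_one[OF unital_subring_polys_over[OF R]]
    by (auto simp: char_poly_matrix_def R polys_over_pCons polys_over_zero[OF R]
        intro!: subring_uminus[OF R])
qed

section \<open>Integrality over a subring, by way of finitely generated modules\<close>

lemma integral_closure_iff:
  "x \<in> integral_closure R \<longleftrightarrow> (\<exists>p\<in>polys_over R. lead_coeff p = 1 \<and> poly p x = 0)"
  by (auto simp: integral_closure_def polys_over_def)

lemma integral_closure_mono: "R \<subseteq> S \<Longrightarrow> integral_closure R \<subseteq> integral_closure S"
  by (force simp: integral_closure_def)

lemma subset_integral_closure: "unital_subring R \<Longrightarrow> R \<subseteq> integral_closure R"
proof
  fix x assume R: "unital_subring R" "x \<in> R"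
  then have "[:- x, 1:] \<in> polys_over R"
    by (simp add: polys_over_pCons polys_over_zero subring_intros)
  then show "x \<in> integral_closure R"
    by (auto simp: integral_closure_iff intro!: bexI[of _ "[:- x, 1:]"])
qed

text \<open>The generators index their own coefficients. Over an infinite \<open>S\<close> every
  such sum is 0 by convention, so the notion is meaningful for finite \<open>S\<close>.\<close>

definition rspan :: "'a::field set \<Rightarrow> 'a set \<Rightarrow> 'a set" where
  "rspan R S = {\<Sum>s\<in>S. c s * s | c. \<forall>s\<in>S. c s \<in> R}"

lemma finite_over_iff_rspan: "finite_over F \<longleftrightarrow> (\<exists>S. finite S \<and> rspan F S = UNIV)"
proof -
  have "rspan F S = UNIV \<longleftrightarrow> (\<forall>x. \<exists>c. (\<forall>s\<in>S. c s \<in> F) \<and> x = (\<Sum>s\<in>S. c s * s))" for S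
    unfolding rspan_def by blast
  then show ?thesis unfolding finite_over_def by presburger
qed

context
  fixes R :: "'a::field set"
  assumes R: "unital_subring R"
begin

lemma rspan_zero: "0 \<in> rspan R S"
  unfolding rspan_def by (auto intro!: exI[of _ "\<lambda>_. 0"] simp: subring_zero[OF R])

lemma rspan_add: "x \<in> rspan R S \<Longrightarrow> y \<in> rspan R S \<Longrightarrow> x + y \<in> rspan R S"
proof -
  assume "x \<in> rspan R S" "y \<in> rspan R S"
  then obtain c d where cd: "\<forall>s\<in>S. c s \<in> R" "\<forall>s\<in>S. d s \<in> R"
    "x = (\<Sum>s\<in>S. c s * s)" "y = (\<Sum>s\<in>S. d s * s)"
    unfolding rspan_def by blast
  then have "x + y = (\<Sum>s\<in>S. (c s + d s) * s)" by (simp add: sum.distrib algebra_simps)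
  with cd show ?thesis unfolding rspan_def using subring_add[OF R]
    by (intro CollectI exI[of _ "\<lambda>s. c s + d s"]) auto
qed

lemma rspan_mult: "a \<in> R \<Longrightarrow> x \<in> rspan R S \<Longrightarrow> a * x \<in> rspan R S"
proof -
  assume a: "a \<in> R" and "x \<in> rspan R S"
  then obtain c where cd: "\<forall>s\<in>S. c s \<in> R" "x = (\<Sum>s\<in>S. c s * s)"
    unfolding rspan_def by blast
  then have "a * x = (\<Sum>s\<in>S. (a * c s) * s)" by (simp add: sum_distrib_left algebra_simps)
  with cd a show ?thesis unfolding rspan_def using subring_mult[OF R]
    by (intro CollectI exI[of _ "\<lambda>s. a * c s"]) auto
qed

lemma rspan_sum: "(\<And>i. i \<in> I \<Longrightarrow> f i \<in> rspan R S) \<Longrightarrow> sum f I \<in> rspan R S"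
  by (induction I rule: infinite_finite_induct) (auto intro: rspan_zero rspan_add)

lemma rspan_base: "finite S \<Longrightarrow> s \<in> S \<Longrightarrow> s \<in> rspan R S"
  unfolding rspan_def
  by (intro CollectI exI[of _ "\<lambda>t. if t = s then 1 else 0"])
    (auto simp: if_distrib[of "\<lambda>u. u * _"] sum.delta subring_intros[OF R] cong: if_cong)

lemma rspan_least:
  assumes "S \<subseteq> N" "0 \<in> N" "\<And>x y. x \<in> N \<Longrightarrow> y \<in> N \<Longrightarrow> x + y \<in> N"
    "\<And>a x. a \<in> R \<Longrightarrow> x \<in> N \<Longrightarrow> a * x \<in> N"
  shows "rspan R S \<subseteq> N"
proof
  fix x assume "x \<in> rspan R S"
  then obtain c where c: "\<forall>s\<in>S. c s \<in> R" "x = (\<Sum>s\<in>S. c s * s)"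
    unfolding rspan_def by blast
  have "(\<Sum>s\<in>T. c s * s) \<in> N" if "T \<subseteq> S" for T
    using that assms c(1) by (induction T rule: infinite_finite_induct) auto
  with c show "x \<in> N" by blast
qed

lemma rspan_mono: "finite T \<Longrightarrow> S \<subseteq> T \<Longrightarrow> rspan R S \<subseteq> rspan R T"
  by (rule rspan_least) (auto intro: rspan_zero rspan_add rspan_mult rspan_base)

text \<open>Cayley--Hamilton: \<open>x\<close> is an eigenvalue of the matrix over \<open>R\<close> by which it acts on the
  generators \<open>S\<close>, the vector of generators being an eigenvector.\<close>

lemma integral_if_stabilizes_rspan:
  assumes S: "finite S" "1 \<in> rspan R S" and stab: "\<And>s. s \<in> S \<Longrightarrow> x * s \<in> rspan R S"
  shows "x \<in> integral_closure R"
proof -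
  obtain f where f: "bij_betw f {0..<card S} S"
    using ex_bij_betw_nat_finite[OF S(1)] by blast
  define n where "n = card S"
  note f = f[folded n_def]
  have "\<forall>s. \<exists>c. s \<in> S \<longrightarrow> (\<forall>t\<in>S. c t \<in> R) \<and> x * s = (\<Sum>t\<in>S. c t * t)"
    using stab unfolding rspan_def by blast
  then obtain C where C: "\<And>s t. s \<in> S \<Longrightarrow> t \<in> S \<Longrightarrow> C s t \<in> R"
    "\<And>s. s \<in> S \<Longrightarrow> x * s = (\<Sum>t\<in>S. C s t * t)" by metis
  define A where "A = mat n n (\<lambda>(i, j). C (f i) (f j))"
  define v where "v = vec n f"
  have A: "A \<in> carrier_mat n n" by (simp add: A_def)
  have fS: "i < n \<Longrightarrow> f i \<in> S" for i using f by (auto simp: bij_betw_def)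
  have "A *\<^sub>v v = x \<cdot>\<^sub>v v"
  proof (rule eq_vecI)
    fix i assume "i < dim_vec (x \<cdot>\<^sub>v v)"
    then have i: "i < n" by (simp add: v_def)
    have "(A *\<^sub>v v) $ i = (\<Sum>j = 0..<n. C (f i) (f j) * f j)"
      using i by (simp add: A_def v_def scalar_prod_def)
    also have "\<dots> = (\<Sum>t\<in>S. C (f i) t * t)"
      using f by (rule sum.reindex_bij_betw)
    also have "\<dots> = x * f i" using C(2) fS i by simp
    finally show "(A *\<^sub>v v) $ i = (x \<cdot>\<^sub>v v) $ i" using i by (simp add: v_def)
  qed (simp add: A_def v_def)
  \<comment> \<open>If all generators vanished, their span could not contain 1.\<close>
  moreover have "v \<noteq> 0\<^sub>v n"
  proof
    assume v: "v = 0\<^sub>v n"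
    have S0: "s = 0" if "s \<in> S" for s
    proof -
      obtain i where "i < n" "s = f i"
        using \<open>s \<in> S\<close> bij_betw_imp_surj_on[OF f] by (metis atLeastLessThan_iff imageE)
      then show ?thesis using arg_cong[OF v, of "\<lambda>v. vec_index v i"] by (simp add: v_def)
    qed
    from S(2) obtain c where "1 = (\<Sum>s\<in>S. c s * s)" by (auto simp: rspan_def)
    also have "\<dots> = 0"
    proof (rule sum.neutral, rule ballI)
      fix s assume "s \<in> S"
      then have "s = 0" by (rule S0)
      then show "c s * s = 0" by (simp only: mult_zero_right)
    qed
    finally show False by (simp only: one_neq_zero)
  qed
  ultimately have "eigenvalue A x"
    unfolding eigenvalue_def eigenvector_def using A by (auto simp: v_def intro!: exI[of _ v])
  then have "poly (char_poly A) x = 0"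
    using eigenvalue_root_char_poly[OF A] by simp
  moreover have "lead_coeff (char_poly A) = 1" using degree_monic_char_poly[OF A] by simp
  moreover have "char_poly A \<in> polys_over R"
    by (rule char_poly_in_polys_over[OF R A]) (auto simp: A_def C fS)
  ultimately show ?thesis by (auto simp: integral_closure_iff)
qed

end

text \<open>\<open>M\<close> must itself be a ring, so this describes finite
  \<open>R\<close>-algebras inside the field.\<close>

definition module_finite :: "'a::field set \<Rightarrow> 'a set \<Rightarrow> bool" where
  "module_finite R M \<longleftrightarrow> unital_subring M \<and> (\<exists>S. finite S \<and> M = rspan R S)"

definition adjoin :: "'a::field set \<Rightarrow> 'a \<Rightarrow> 'a set" where
  "adjoin R x = {poly p x | p. p \<in> polys_over R}"

lemma module_finite_subset:
  assumes "unital_subring R" "module_finite R M" shows "R \<subseteq> M"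
proof
  fix a assume "a \<in> R"
  from assms obtain S where S: "M = rspan R S" and "1 \<in> M"
    by (auto simp: module_finite_def subring_one)
  then show "a \<in> M" using rspan_mult[OF assms(1) \<open>a \<in> R\<close>, of 1 S] by simp
qed

text \<open>\<open>M\<close> contains 1 and is stable under multiplication by its own element
  \<open>x\<close>, so \<open>integral_if_stabilizes_rspan\<close> applies.\<close>

lemma module_finite_integral:
  assumes R: "unital_subring R" and M: "module_finite R M" and "x \<in> M"
  shows "x \<in> integral_closure R"
proof -
  from M obtain S where S: "finite S" "M = rspan R S" and M': "unital_subring M"
    by (auto simp: module_finite_def)
  show ?thesis
    using S \<open>x \<in> M\<close> rspan_base[OF R S(1)] subring_one[OF M'] subring_mult[OF M']
    by (intro integral_if_stabilizes_rspan[OF R S(1)]) auto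
qed

text \<open>The products of generators of \<open>M\<close> over \<open>R\<close> with generators of
  \<open>N\<close> over \<open>M\<close> generate \<open>N\<close> over \<open>R\<close>.\<close>

lemma module_finite_trans:
  assumes R: "unital_subring R" and M: "module_finite R M" and N: "module_finite M N"
  shows "module_finite R N"
proof -
  from M obtain S where S: "finite S" "M = rspan R S" and M': "unital_subring M"
    by (auto simp: module_finite_def)
  from N obtain T where T: "finite T" "N = rspan M T" and N': "unital_subring N"
    by (auto simp: module_finite_def)
  let ?U = "(\<lambda>(s, t). s * t) ` (S \<times> T)"
  have fin: "finite ?U" using S T by simp
  note RI = rspan_zero[OF R] rspan_add[OF R] rspan_mult[OF R]
  have MN: "M \<subseteq> N" by (rule module_finite_subset[OF M' N])
  have RN: "R \<subseteq> N" using module_finite_subset[OF R M] MN by blast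
  have "S \<subseteq> N" using S MN rspan_base[OF R] by blast
  moreover have "T \<subseteq> N" using T rspan_base[OF M'] by blast
  ultimately have "rspan R ?U \<subseteq> N"
    using RN by (intro rspan_least[OF R])
      (auto intro: subring_zero[OF N'] subring_add[OF N'] subring_mult[OF N'])
  moreover have "N \<subseteq> rspan R ?U"
    unfolding T
  proof
    fix x assume "x \<in> rspan M T"
    then obtain c where c: "\<forall>t\<in>T. c t \<in> rspan R S" "x = (\<Sum>t\<in>T. c t * t)"
      unfolding rspan_def S(2) by blast
    have "rspan R S \<subseteq> {y. y * t \<in> rspan R ?U}" if "t \<in> T" for t
      using that fin by (intro rspan_least[OF R])
        (auto simp: distrib_right mult.assoc RI intro: rspan_base[OF R fin])
    then show "x \<in> rspan R ?U" unfolding c(2) using c(1)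
      by (intro rspan_sum[OF R]) auto
  qed
  ultimately show ?thesis using fin N' by (auto simp: module_finite_def)
qed

text \<open>Long division by a monic polynomial never inverts a coefficient, so quotient and
  remainder stay over \<open>R\<close>. Each step of the induction cancels the leading term of
  \<open>g\<close>.\<close>

lemma polys_over_div_monic:
  fixes R :: "'a::field set"
  assumes R: "unital_subring R" and f: "f \<in> polys_over R" "lead_coeff f = 1"
    and "g \<in> polys_over R"
  shows "\<exists>q\<in>polys_over R. \<exists>r\<in>polys_over R. g = q * f + r \<and> (r = 0 \<or> degree r < degree f)"
  using \<open>g \<in> polys_over R\<close>
proof (induction "degree g" arbitrary: g rule: less_induct)
  case less
  note pI = polys_over_intros[OF R]
  show ?case
  proof (cases "g = 0 \<or> degree g < degree f")
    case True
    then show ?thesis using less.prems by (intro bexI[of _ 0] bexI[of _ g]) (auto intro: pI)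
  next
    case False
    define h where "h = monom (lead_coeff g) (degree g - degree f)"
    have h: "h \<in> polys_over R"
      using less.prems by (auto simp: h_def polys_over_def subring_zero[OF R])
    let ?g = "g - h * f"
    have g': "?g \<in> polys_over R" using less.prems f h by (auto intro: pI)
    have g0: "g \<noteq> 0" using False by simp
    have f0: "f \<noteq> 0" using f by auto
    have h0: "h \<noteq> 0" using g0 by (simp add: h_def)
    have dh: "degree h = degree g - degree f" "lead_coeff h = lead_coeff g"
      using g0 unfolding h_def lead_coeff_monom by (simp_all add: degree_monom_eq)
    have "degree (h * f) = degree g" using degree_mult_eq[OF h0 f0] dh False by simp
    moreover have "lead_coeff (h * f) = lead_coeff g"
      unfolding lead_coeff_mult dh(2) f(2) by simp
    ultimately have *: "coeff ?g (degree g) = 0" "degree ?g \<le> degree g"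
      by (auto intro: degree_diff_le)
    have "\<exists>q\<in>polys_over R. \<exists>r\<in>polys_over R. ?g = q * f + r \<and> (r = 0 \<or> degree r < degree f)"
    proof (cases "?g = 0")
      case True
      then show ?thesis by (intro bexI[of _ 0]) (auto intro: pI)
    next
      case False
      with * have "degree ?g < degree g"
        by (metis le_neq_implies_less leading_coeff_0_iff)
      then show ?thesis using less.hyps g' by blast
    qed
    then obtain q r where qr: "q \<in> polys_over R" "r \<in> polys_over R" "?g = q * f + r"
      "r = 0 \<or> degree r < degree f" by blast
    then have "g = (q + h) * f + r" by (simp add: algebra_simps)
    with qr h show ?thesis by (blast intro: pI)
  qed
qed

context
  fixes R :: "'a::field set"
  assumes R: "unital_subring R"
begin

lemma adjoin_contains: "R \<subseteq> adjoin R x" "x \<in> adjoin R x"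
proof -
  show "R \<subseteq> adjoin R x"
    unfolding adjoin_def using polys_over_const[OF R] by (force intro: exI[of _ "[:_:]"])
  show "x \<in> adjoin R x"
    unfolding adjoin_def using polys_over_X[OF R] by (force intro: exI[of _ "[:0, 1:]"])
qed

lemma adjoin_least: "unital_subring M \<Longrightarrow> R \<subseteq> M \<Longrightarrow> x \<in> M \<Longrightarrow> adjoin R x \<subseteq> M"
  unfolding adjoin_def by (auto intro!: poly_in_subring simp: polys_over_def subset_iff)

lemma unital_subring_adjoin: "unital_subring (adjoin R x)"
proof (rule unital_subringI)
  show "1 \<in> adjoin R x" using adjoin_contains subring_one[OF R] by blast
  note pI = polys_over_intros[OF R]
  fix y z assume "y \<in> adjoin R x" "z \<in> adjoin R x"
  then obtain p q where "p \<in> polys_over R" "q \<in> polys_over R" "y = poly p x" "z = poly q x"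
    unfolding adjoin_def by blast
  then have "y - z = poly (p - q) x" "p - q \<in> polys_over R"
    "y * z = poly (p * q) x" "p * q \<in> polys_over R"
    by (simp_all add: pI)
  then show "y - z \<in> adjoin R x" "y * z \<in> adjoin R x"
    unfolding adjoin_def by blast+
qed

text \<open>Reduction modulo a monic equation \<open>f\<close> of \<open>x\<close> leaves only the
  powers of \<open>x\<close> below \<open>degree f\<close> as generators.\<close>

lemma module_finite_adjoin:
  assumes "x \<in> integral_closure R"
  shows "module_finite R (adjoin R x)"
proof -
  from assms obtain f where f: "f \<in> polys_over R" "lead_coeff f = 1" "poly f x = 0"
    by (auto simp: integral_closure_iff)
  let ?S = "(\<lambda>i. x ^ i) ` {..<degree f}"
  have "adjoin R x \<subseteq> rspan R ?S"
  proof
    fix y assume "y \<in> adjoin R x"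
    then obtain g where g: "g \<in> polys_over R" "y = poly g x" by (auto simp: adjoin_def)
    obtain q r where qr: "r \<in> polys_over R" "g = q * f + r" "r = 0 \<or> degree r < degree f"
      using polys_over_div_monic[OF R f(1,2) g(1)] by blast
    have y: "y = poly r x" using qr g f by simp
    show "y \<in> rspan R ?S"
    proof (cases "r = 0")
      case True
      then show ?thesis using y rspan_zero[OF R] by simp
    next
      case False
      then show ?thesis unfolding y poly_altdef using qr
        by (intro rspan_sum[OF R] rspan_mult[OF R] rspan_base[OF R]) (auto simp: polys_over_def)
    qed
  qed
  moreover have "rspan R ?S \<subseteq> adjoin R x"
    using adjoin_contains[of x] unital_subring_adjoin[of x] R
    by (intro rspan_least) (auto intro!: subring_power subring_zero intro: subring_add subring_mult)
  ultimately show ?thesis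
    using unital_subring_adjoin by (auto simp: module_finite_def intro!: exI[of _ ?S])
qed

end

text \<open>Adjoining \<open>x\<close> and then \<open>y\<close> gives a ring that is a finite
  \<open>R\<close>-module by transitivity. It contains the difference and the product, which are
  therefore integral.\<close>

lemma unital_subring_integral_closure:
  assumes R: "unital_subring R"
  shows "unital_subring (integral_closure R)"
proof (rule unital_subringI)
  show "1 \<in> integral_closure R" using subset_integral_closure[OF R] subring_one[OF R] by blast
  fix x y assume x: "x \<in> integral_closure R" and y: "y \<in> integral_closure R"
  let ?M = "adjoin R x"
  have M: "module_finite R ?M" by (rule module_finite_adjoin[OF R x])
  have M': "unital_subring ?M" by (rule unital_subring_adjoin[OF R])
  have "y \<in> integral_closure ?M" using y integral_closure_mono[OF adjoin_contains(1)[OF R]] by blast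
  then have "module_finite R (adjoin ?M y)"
    by (rule module_finite_trans[OF R M module_finite_adjoin[OF M']])
  moreover have "x \<in> adjoin ?M y" "y \<in> adjoin ?M y"
    using adjoin_contains[OF M'] adjoin_contains[OF R] by blast+
  ultimately show "x - y \<in> integral_closure R" "x * y \<in> integral_closure R"
    using unital_subring_adjoin[OF M'] module_finite_integral[OF R]
    by (auto simp: subring_intros)
qed

text \<open>The elements are adjoined one at a time, each step being finite over the ring before
  it.\<close>

lemma finite_subset_module_finite:
  assumes R: "unital_subring R" and "finite T" "T \<subseteq> integral_closure R"
  shows "\<exists>M. module_finite R M \<and> T \<subseteq> M"
  using assms(2,3)
proof (induction T rule: finite_induct)
  case empty
  have "R = {c 1 | c. c (1::'a) \<in> R}" by (auto intro: exI[of _ "\<lambda>_. _"])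
  also have "\<dots> = rspan R {1}" by (simp add: rspan_def)
  finally have "R = rspan R {1}" .
  then have "module_finite R R" unfolding module_finite_def using R by blast
  then show ?case by blast
next
  case (insert x T)
  then obtain M where M: "module_finite R M" "T \<subseteq> M" by blast
  then have M': "unital_subring M" by (simp add: module_finite_def)
  have "x \<in> integral_closure M"
    using insert.prems integral_closure_mono[OF module_finite_subset[OF R M(1)]] by blast
  then have "module_finite R (adjoin M x)"
    by (rule module_finite_trans[OF R M(1) module_finite_adjoin[OF M']])
  then show ?case using adjoin_contains[OF M', of x] M(2) by blast
qed

text \<open>An integral equation has only finitely many coefficients. They lie in one finite
  \<open>R\<close>-algebra \<open>M\<close>, and adjoining \<open>x\<close> to \<open>M\<close> is
  again finite over \<open>R\<close>.\<close>

lemma integral_closure_idem: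
  assumes R: "unital_subring R"
  shows "integral_closure (integral_closure R) = integral_closure R"
proof
  show "integral_closure (integral_closure R) \<subseteq> integral_closure R"
  proof
    fix x assume "x \<in> integral_closure (integral_closure R)"
    then obtain p where p: "p \<in> polys_over (integral_closure R)" "lead_coeff p = 1" "poly p x = 0"
      by (auto simp: integral_closure_iff)
    have "finite (range (coeff p))"
    proof (rule finite_subset)
      have "coeff p i = 0 \<or> i \<le> degree p" for i using coeff_eq_0[of p i] by linarith
      then show "range (coeff p) \<subseteq> insert 0 (coeff p ` {..degree p})" by blast
    qed simp
    moreover have "range (coeff p) \<subseteq> integral_closure R" using p by (auto simp: polys_over_def)
    ultimately obtain M where M: "module_finite R M" "range (coeff p) \<subseteq> M"
      using finite_subset_module_finite[OF R] by blast
    then have M': "unital_subring M" by (simp add: module_finite_def)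
    have "p \<in> polys_over M" using M(2) by (auto simp: polys_over_def)
    then have "x \<in> integral_closure M" using p by (auto simp: integral_closure_iff)
    then have "module_finite R (adjoin M x)"
      by (rule module_finite_trans[OF R M(1) module_finite_adjoin[OF M']])
    then show "x \<in> integral_closure R"
      using module_finite_integral[OF R] adjoin_contains[OF M'] by blast
  qed
qed (rule subset_integral_closure[OF unital_subring_integral_closure[OF R]])

section \<open>Subfields, denominators and minimal polynomials\<close>

definition subfield_set :: "'a::field set \<Rightarrow> bool" where
  "subfield_set F \<longleftrightarrow> unital_subring F \<and> (\<forall>x\<in>F. inverse x \<in> F)"

lemma subfield_setD: "subfield_set F \<Longrightarrow> unital_subring F"
  by (simp add: subfield_set_def)

lemma subfield_set_divide: "subfield_set F \<Longrightarrow> x \<in> F \<Longrightarrow> y \<in> F \<Longrightarrow> x / y \<in> F"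
  unfolding subfield_set_def divide_inverse by (auto intro: subring_mult)

lemma subfield_set_fractions:
  assumes A: "unital_subring A"
  shows "subfield_set (fractions A)"
  unfolding subfield_set_def
proof (intro conjI unital_subringI ballI)
  note AI = subring_intros[OF A]
  show "1 \<in> fractions A"
    unfolding fractions_def using AI by (auto intro!: exI[of _ 1])
  fix x assume "x \<in> fractions A"
  then obtain a b where x: "a \<in> A" "b \<in> A" "b \<noteq> 0" "x = a / b" by (auto simp: fractions_def)
  have "inverse x = (if a = 0 then 0 / 1 else b / a)" using x by simp
  with x show "inverse x \<in> fractions A"
    unfolding fractions_def using AI(1,2) by (cases "a = 0") fastforce+
  fix y assume "y \<in> fractions A"
  then obtain c d where y: "c \<in> A" "d \<in> A" "d \<noteq> 0" "y = c / d" by (auto simp: fractions_def)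
  have "x - y = (a * d - c * b) / (b * d)" "x * y = (a * c) / (b * d)"
    using x y by (simp_all add: field_simps)
  moreover have "a * d - c * b \<in> A" "a * c \<in> A" "b * d \<in> A" "b * d \<noteq> 0"
    using x y by (auto intro!: AI)
  ultimately show "x - y \<in> fractions A" "x * y \<in> fractions A"
    unfolding fractions_def by blast+
qed

lemma subset_fractions:
  fixes A :: "'a::field set"
  shows "unital_subring A \<Longrightarrow> A \<subseteq> fractions A"
proof
  fix x assume "unital_subring A" "x \<in> A"
  then have "x = x / 1 \<and> x \<in> A \<and> 1 \<in> A \<and> (1::'a) \<noteq> 0" by (simp add: subring_one)
  then show "x \<in> fractions A" unfolding fractions_def by blast
qed

lemma fractions_common_denominator:
  assumes A: "unital_subring A" and "finite I" "\<And>i. i \<in> I \<Longrightarrow> f i \<in> fractions A"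
  shows "\<exists>d\<in>A. d \<noteq> 0 \<and> (\<forall>i\<in>I. d * f i \<in> A)"
  using assms(2,3)
proof (induction I rule: finite_induct)
  case empty
  then show ?case using subring_one[OF A] by (auto intro!: bexI[of _ 1])
next
  case (insert j I)
  then obtain d where d: "d \<in> A" "d \<noteq> 0" "\<forall>i\<in>I. d * f i \<in> A" by auto
  from insert.prems[of j] obtain a b where ab: "a \<in> A" "b \<in> A" "b \<noteq> 0" "f j = a / b"
    by (auto simp: fractions_def)
  have "b * d * f j = d * a" using ab by simp
  moreover have "b * d * f i = b * (d * f i)" for i by simp
  ultimately show ?case
    using d ab subring_mult[OF A] by (intro bexI[of _ "b * d"]) (metis insertE mult_eq_0_iff, blast)
qed

lemma integral_denominator:
  assumes A: "unital_subring A" and "x \<in> integral_closure (fractions A)"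
  shows "\<exists>d\<in>A. d \<noteq> 0 \<and> d * x \<in> integral_closure A"
proof -
  from assms obtain p where p: "p \<in> polys_over (fractions A)" "lead_coeff p = 1" "poly p x = 0"
    by (auto simp: integral_closure_iff)
  obtain d where d: "d \<in> A" "d \<noteq> 0" "\<forall>i\<le>degree p. d * coeff p i \<in> A"
    using fractions_common_denominator[OF A, of "{..degree p}" "coeff p"] p(1)
    by (auto simp: polys_over_def)
  let ?n = "degree p"
  \<comment> \<open>With n = \<open>?n\<close> this is d^n p(X/d). It stays monic, has the root
    \<open>d * x\<close>, and each coefficient below the top gains at least one factor
    \<open>d\<close>.\<close>
  define q where "q = (\<Sum>i\<le>?n. monom (d ^ (?n - i) * coeff p i) i)"
  have cq: "coeff q i = (if i \<le> ?n then d ^ (?n - i) * coeff p i else 0)" for i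
    by (simp add: q_def coeff_sum if_distrib cong: if_cong)
  have dq: "degree q = ?n"
    using p(2) cq by (intro antisym degree_le le_degree) auto
  have "coeff q i \<in> A" for i
  proof -
    consider "i < ?n" | "i = ?n" | "i > ?n" by linarith
    then show ?thesis
    proof cases
      case 1
      then obtain k where k: "?n - i = Suc k" by (metis Suc_diff_Suc)
      then have "coeff q i = d ^ k * (d * coeff p i)" using 1 cq by (simp add: algebra_simps)
      moreover have "d * coeff p i \<in> A" using d 1 by simp
      ultimately show ?thesis using d(1) by (simp add: subring_mult[OF A] subring_power[OF A])
    qed (use cq p(2) in \<open>auto intro: subring_zero[OF A] subring_one[OF A]\<close>)
  qed
  moreover have "lead_coeff q = 1" using dq cq p(2) by simp
  moreover have "poly q (d * x) = d ^ ?n * poly p x"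
    unfolding poly_altdef dq sum_distrib_left
  proof (rule sum.cong)
    fix i assume "i \<in> {..?n}"
    then have "d ^ ?n = d ^ (?n - i) * d ^ i" by (simp flip: power_add)
    then show "coeff q i * (d * x) ^ i = d ^ ?n * (coeff p i * x ^ i)"
      using \<open>i \<in> _\<close> by (simp add: cq power_mult_distrib)
  qed simp
  ultimately have "d * x \<in> integral_closure A"
    using p(3) by (auto simp: integral_closure_def)
  with d show ?thesis by blast
qed

lemma finite_over_algebraic:
  assumes F: "unital_subring F" and "finite_over F"
  shows "integral_closure F = UNIV"
proof -
  from assms obtain S where S: "finite S" "rspan F S = UNIV" by (auto simp: finite_over_iff_rspan)
  have "x \<in> integral_closure F" for x
    by (rule integral_if_stabilizes_rspan[OF F S(1)]) (simp_all add: S)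
  then show ?thesis by blast
qed

text \<open>Write the equation as a + x p(x) = 0. If a is nonzero then 1/x = -p(x)/a; if a = 0 then
  \<open>p\<close> itself annihilates the nonzero element \<open>x\<close>, and the induction
  continues.\<close>

lemma inverse_in_adjoin:
  assumes F: "subfield_set F" and "p \<in> polys_over F" "p \<noteq> 0" "poly p x = 0" "x \<noteq> 0"
  shows "inverse x \<in> adjoin F x"
  using assms(2-4)
proof (induction p)
  case (pCons a p)
  note F' = subfield_setD[OF F]
  have aF: "a \<in> F" and pF: "p \<in> polys_over F" using pCons.prems by (auto simp: polys_over_pCons[OF F'])
  show ?case
  proof (cases "a = 0")
    case True
    then show ?thesis using pCons \<open>x \<noteq> 0\<close> pF by auto
  next
    case False
    have "inverse x = - (inverse a * poly p x)"
      using pCons.prems(3) False \<open>x \<noteq> 0\<close> by (simp add: field_simps add_eq_0_iff2)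
    also have "\<dots> = poly (smult (- inverse a) p) x" by simp
    finally show ?thesis
      unfolding adjoin_def using F aF pF
      by (auto simp: subfield_set_def intro!: exI[of _ "smult (- inverse a) p"]
          polys_over_smult[OF F'] subring_uminus[OF F'])
  qed
qed simp

lemma subfield_set_adjoin:
  assumes F: "subfield_set F" and x: "x \<in> integral_closure F"
  shows "subfield_set (adjoin F x)"
  unfolding subfield_set_def
proof (intro conjI ballI)
  note F' = subfield_setD[OF F]
  show R: "unital_subring (adjoin F x)" by (rule unital_subring_adjoin[OF F'])
  fix y assume y: "y \<in> adjoin F x"
  show "inverse y \<in> adjoin F x"
  proof (cases "y = 0")
    case False
    have "y \<in> integral_closure F"
      by (rule module_finite_integral[OF F' module_finite_adjoin[OF F' x] y])
    then obtain p where "p \<in> polys_over F" "lead_coeff p = 1" "poly p y = 0"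
      by (auto simp: integral_closure_iff)
    then have "inverse y \<in> adjoin F y"
      using False by (intro inverse_in_adjoin[OF F, of p]) auto
    also have "\<dots> \<subseteq> adjoin F x"
      by (rule adjoin_least[OF F' R adjoin_contains(1)[OF F'] y])
    finally show ?thesis .
  qed (use subring_zero[OF R] in simp)
qed

text \<open>A monic annihilator \<open>f\<close> of least degree is taken. The remainder of any
  other annihilator modulo \<open>f\<close>, rescaled to be monic, would have smaller degree, so it
  is 0.\<close>

lemma minimal_polynomial_exists:
  assumes F: "subfield_set F" and x: "x \<in> integral_closure F"
  obtains f where "f \<in> polys_over F" "lead_coeff f = 1" "poly f x = 0"
    "\<And>g. g \<in> polys_over F \<Longrightarrow> poly g x = 0 \<Longrightarrow> \<exists>q\<in>polys_over F. g = q * f"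
proof -
  note F' = subfield_setD[OF F]
  define P where "P = (\<lambda>f. f \<in> polys_over F \<and> lead_coeff f = 1 \<and> poly f x = 0)"
  obtain f0 where "P f0" using x by (auto simp: integral_closure_iff P_def)
  define f where "f = arg_min degree P"
  have f: "P f" "\<And>g. P g \<Longrightarrow> degree f \<le> degree g"
    using arg_min_nat_lemma[of P f0 degree, OF \<open>P f0\<close>] by (auto simp: f_def)
  have "\<exists>q\<in>polys_over F. g = q * f" if g: "g \<in> polys_over F" "poly g x = 0" for g
  proof -
    obtain q r where qr: "q \<in> polys_over F" "r \<in> polys_over F" "g = q * f + r"
      "r = 0 \<or> degree r < degree f"
      using polys_over_div_monic[OF F' _ _ g(1), of f] f(1) by (auto simp: P_def)
    have "r = 0"
    proof (rule ccontr)
      assume r: "r \<noteq> 0"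
      have "inverse (lead_coeff r) \<in> F" using F qr(2) by (auto simp: subfield_set_def polys_over_def)
      then have "P (smult (inverse (lead_coeff r)) r)"
        using qr g f(1) r by (auto simp: P_def intro: polys_over_smult[OF F'])
      from f(2)[OF this] show False using qr(4) r by simp
    qed
    with qr show ?thesis by auto
  qed
  with f(1) that show thesis unfolding P_def by blast
qed

section \<open>Interpolation at the roots of a split polynomial, and integrality along
  embeddings\<close>

text \<open>Lagrange interpolation: \<open>h\<close> and \<open>g\<close> agree at
  \<open>card S\<close> points and have smaller degree, so they are equal. Each \<open>P s\<close>
  is monic of degree \<open>card S - 1\<close>, and f = (X - s) P(s) makes its value at
  \<open>s\<close> equal to f'(s).\<close>

lemma lagrange_top_coeff:
  fixes S :: "'a::field set" and g :: "'a poly"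
  assumes S: "finite S" and f: "f = (\<Prod>s\<in>S. [:- s, 1:])" and g: "degree g < card S"
  shows "coeff g (card S - 1) = (\<Sum>s\<in>S. poly g s / poly (pderiv f) s)"
proof -
  define P where "P s = (\<Prod>t\<in>S - {s}. [:- t, 1:])" for s
  have P: "degree (P s) = card S - 1" "coeff (P s) (card S - 1) = 1" if "s \<in> S" for s
  proof -
    have "lead_coeff (P s) = 1" by (simp add: P_def lead_coeff_prod)
    moreover show "degree (P s) = card S - 1"
      unfolding P_def using S that by (subst degree_prod_eq_sum_degree) auto
    ultimately show "coeff (P s) (card S - 1) = 1" by simp
  qed
  have P0: "poly (P s) t = 0" if "s \<in> S" "t \<in> S" "s \<noteq> t" for s t
    using that S by (auto simp: P_def poly_prod intro!: prod_zero bexI[of _ t])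
  have P1: "poly (P s) s = poly (pderiv f) s" "poly (P s) s \<noteq> 0" if s: "s \<in> S" for s
  proof -
    have "f = [:- s, 1:] * P s" unfolding f P_def using S s by (simp add: prod.remove)
    then have "pderiv f = [:- s, 1:] * pderiv (P s) + P s * pderiv [:- s, 1:]"
      by (simp only: pderiv_mult)
    then show "poly (P s) s = poly (pderiv f) s"
      by (simp add: pderiv_pCons)
    show "poly (P s) s \<noteq> 0" using S by (simp add: P_def poly_prod)
  qed
  define h where "h = (\<Sum>s\<in>S. smult (poly g s / poly (pderiv f) s) (P s))"
  have "degree h \<le> card S - 1"
    unfolding h_def using P(1) by (intro degree_sum_le S) (auto intro: order.trans[OF degree_smult_le])
  then have deg: "degree (g - h) < card S" using g by (intro degree_diff_less) auto
  have "poly h t = poly g t" if "t \<in> S" for t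
  proof -
    have "poly h t = (\<Sum>s\<in>S. if s = t then poly g t else 0)"
      unfolding h_def poly_sum using P0 P1 that by (intro sum.cong) auto
    then show ?thesis using that S by simp
  qed
  then have "S \<subseteq> {t. poly (g - h) t = 0}" by auto
  then have "g - h = 0"
    using deg card_mono[of "{t. poly (g - h) t = 0}" S] poly_roots_finite[of "g - h"]
      card_poly_roots_bound[of "g - h"] by fastforce
  then have "coeff g (card S - 1) = coeff h (card S - 1)" by simp
  also have "\<dots> = (\<Sum>s\<in>S. poly g s / poly (pderiv f) s)"
    unfolding h_def coeff_sum using P by (intro sum.cong) auto
  finally show ?thesis .
qed

text \<open>A multiple root would also be a root of the derivative, so the multiset of roots given
  by algebraic closedness is a set.\<close>

lemma monic_separable_splits:
  fixes f :: "'a::alg_closed_field poly"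
  assumes f: "lead_coeff f = 1" and sep: "\<And>s. poly f s = 0 \<Longrightarrow> poly (pderiv f) s \<noteq> 0"
  obtains S where "finite S" "f = (\<Prod>s\<in>S. [:- s, 1:])"
proof -
  have "f \<noteq> 0" using f by auto
  then obtain M where M: "f = (\<Prod>s\<in>#M. [:- s, 1:])"
    using alg_closed_imp_factorization[of f] f by auto
  have "count M s \<le> 1" for s
  proof (rule ccontr)
    assume "\<not> count M s \<le> 1"
    then have "replicate_mset 2 s \<subseteq># M" by (simp flip: count_le_replicate_mset_subset_eq)
    then obtain N where "M = replicate_mset 2 s + N" by (auto simp: subset_mset.le_iff_add)
    then have "f = [:- s, 1:] * ([:- s, 1:] * (\<Prod>s\<in>#N. [:- s, 1:]))"
      by (simp add: M numeral_2_eq_2)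
    then have "poly f s = 0" "poly (pderiv f) s = 0"
      by (simp_all add: pderiv_mult del: mult_pCons_left)
    with sep show False by blast
  qed
  then have "M = mset_set (set_mset M)"
    by (intro multiset_eqI) (metis count_mset_set(1,3) finite_set_mset le_antisym less_one not_le count_eq_zero_iff)
  then have "f = (\<Prod>s\<in>set_mset M. [:- s, 1:])"
    unfolding M by (metis prod_unfold_prod_mset)
  with that show thesis by blast
qed

text \<open>Coefficients are pushed forward along \<open>e\<close>, and pulled back because a field
  homomorphism is injective. This moves integrality between a field and its algebraic closure, and
  between \<open>K\<close> and \<open>L\<close>.\<close>

lemma integral_closure_hom:
  fixes e :: "'a::field \<Rightarrow> 'b::field"
  assumes "field_hom e"
  shows "e x \<in> integral_closure (e ` A) \<longleftrightarrow> x \<in> integral_closure A"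
proof
  interpret e: field_hom e by fact
  assume "x \<in> integral_closure A"
  then obtain p where p: "\<forall>i. coeff p i \<in> A" "lead_coeff p = 1" "poly p x = 0"
    by (auto simp: integral_closure_def)
  then show "e x \<in> integral_closure (e ` A)"
    unfolding integral_closure_def
    by (auto intro!: exI[of _ "map_poly e p"])
next
  interpret e: field_hom e by fact
  assume "e x \<in> integral_closure (e ` A)"
  then obtain p where p: "\<forall>i. coeff p i \<in> e ` A" "lead_coeff p = 1" "poly p (e x) = 0"
    by (auto simp: integral_closure_def)
  then have r: "\<forall>i. coeff p i \<in> range e" by blast
  define q where "q = map_poly (inv_into UNIV e) p"
  have inv: "inv_into UNIV e (e a) = a" for a by (rule inv_f_f) (simp add: inj_def)
  have inv0: "inv_into UNIV e 0 = 0" using inv[of 0] by simp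
  have cq: "coeff q i = inv_into UNIV e (coeff p i)" for i
    unfolding q_def using inv0 by (rule coeff_map_poly)
  have "map_poly e q = p"
    using r by (intro poly_eqI) (simp only: cq e.coeff_map_poly_hom f_inv_into_f)
  moreover have "coeff q i \<in> A" for i
  proof -
    obtain a where "a \<in> A" "coeff p i = e a" using p(1) by blast
    then show ?thesis by (simp only: cq inv)
  qed
  moreover have "lead_coeff q = 1" "poly q x = 0"
    using p(2,3) unfolding calculation(1)[symmetric] by simp_all
  ultimately show "x \<in> integral_closure A"
    unfolding integral_closure_def by blast
qed

subsection \<open>Integral linear functionals on separable extensions\<close>

lemma field_hom_to_ac: "field_hom to_ac"
  by standard simp_all

text \<open>\<open>A\<close> stands for the image of the ring of integers of \<open>K\<close> in
  \<open>L\<close>, and \<open>fractions A\<close> for the image of \<open>K\<close>. Separability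
  says that each \<open>x\<close> is a simple root of some polynomial; this passes to the minimal
  polynomial over any intermediate field, which divides it.\<close>

locale separable_order =
  fixes A :: "'a::field set"
  assumes order: "unital_subring A"
    and integrally_closed: "integral_closure A \<inter> fractions A \<subseteq> A"
    and finite_over_fractions: "finite_over (fractions A)"
    and separable:
      "\<exists>p\<in>polys_over (fractions A). poly p x = 0 \<and> poly (pderiv p) x \<noteq> 0"
begin

lemmas order_integral = unital_subring_integral_closure[OF order]

lemma subfield_fractions: "subfield_set (fractions A)"
  by (rule subfield_set_fractions[OF order])

lemma order_subset: "A \<subseteq> integral_closure A"
  by (rule subset_integral_closure[OF order])

lemma algebraic: "x \<in> integral_closure (fractions A)"
  using finite_over_algebraic[OF subfield_setD[OF subfield_fractions] finite_over_fractions] by simp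

lemma denominator: "\<exists>d\<in>A. d \<noteq> 0 \<and> d * x \<in> integral_closure A"
  by (rule integral_denominator[OF order algebraic])

lemma common_denominator:
  assumes "finite I"
  shows "\<exists>d\<in>A. d \<noteq> 0 \<and> (\<forall>i\<in>I. d * f i \<in> integral_closure A)"
  using assms
proof (induction I rule: finite_induct)
  case empty
  then show ?case using subring_one[OF order] by (auto intro!: bexI[of _ 1])
next
  case (insert j I)
  then obtain d where d: "d \<in> A" "d \<noteq> 0" "\<forall>i\<in>I. d * f i \<in> integral_closure A" by auto
  obtain e where e: "e \<in> A" "e \<noteq> 0" "e * f j \<in> integral_closure A" using denominator by blast
  have "e * d * f i \<in> integral_closure A" if "i \<in> insert j I" for i
  proof (cases "i = j")
    case True
    have "d * (e * f j) \<in> integral_closure A"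
      using d(1) e(3) order_subset by (blast intro: subring_mult[OF order_integral])
    then show ?thesis using True by (simp add: mult.left_commute mult.commute)
  next
    case False
    then have "e * (d * f i) \<in> integral_closure A"
      using that d(3) e(1) order_subset by (blast intro: subring_mult[OF order_integral])
    then show ?thesis by (simp add: mult.assoc)
  qed
  moreover have "e * d \<in> A" "e * d \<noteq> 0" using d e by (auto intro: subring_mult[OF order])
  ultimately show ?case by blast
qed

text \<open>If p is a monic equation over \<open>A\<close> for g(x), then \<open>f\<close> divides
  the composite p(g(X)). So every root \<open>s\<close> of \<open>f\<close> in the algebraic closure
  satisfies p(g(s)) = 0.\<close>

lemma conjugate_integral:
  assumes F: "subfield_set F" "fractions A \<subseteq> F"
    and f: "f \<in> polys_over F" "poly f x = 0"
      "\<And>g. g \<in> polys_over F \<Longrightarrow> poly g x = 0 \<Longrightarrow> \<exists>q\<in>polys_over F. g = q * f"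
    and g: "g \<in> polys_over F" "poly g x \<in> integral_closure A"
    and s: "poly (map_poly to_ac f) s = 0"
  shows "poly (map_poly to_ac g) s \<in> integral_closure (to_ac ` A)"
proof -
  interpret e: field_hom to_ac by (rule field_hom_to_ac)
  interpret m: map_poly_idom_hom to_ac ..
  obtain p where p: "p \<in> polys_over A" "lead_coeff p = 1" "poly p (poly g x) = 0"
    using g(2) by (auto simp: integral_closure_iff)
  have "p \<in> polys_over F"
    using p(1) F(2) subset_fractions[OF order] by (auto simp: polys_over_def)
  then have "pcompose p g \<in> polys_over F"
    by (rule pcompose_in_polys_over[OF subfield_setD[OF F(1)] _ g(1)])
  moreover have "poly (pcompose p g) x = 0" using p(3) by (simp add: poly_pcompose)
  ultimately obtain q where "pcompose p g = q * f" using f(3) by blast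
  then have "map_poly to_ac (pcompose p g) = map_poly to_ac q * map_poly to_ac f"
    by (simp add: hom_distribs)
  then have "poly (map_poly to_ac (pcompose p g)) s = 0" using s by simp
  then have "poly (map_poly to_ac p) (poly (map_poly to_ac g) s) = 0"
    by (simp add: e.map_poly_pcompose poly_pcompose)
  then show ?thesis
    using p(1,2) unfolding integral_closure_def polys_over_def
    by (auto intro!: exI[of _ "map_poly to_ac p"])
qed

text \<open>The value of \<open>\<tau>\<close> on \<open>y = g(x)\<close> is a multiple of the top coefficient of \<open>g\<close>, which is
  the trace of \<open>y / f'(x)\<close> for the minimal polynomial \<open>f\<close> of \<open>x\<close> (Euler).\<close>

lemma integral_functional_step:
  assumes F: "subfield_set F" "fractions A \<subseteq> F" and x: "x \<in> integral_closure A"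
  obtains \<tau> where
    "\<And>y z. y \<in> adjoin F x \<Longrightarrow> z \<in> adjoin F x \<Longrightarrow> \<tau> (y + z) = \<tau> y + \<tau> z"
    "\<And>c y. c \<in> F \<Longrightarrow> y \<in> adjoin F x \<Longrightarrow> \<tau> (c * y) = c * \<tau> y"
    "\<And>y. y \<in> adjoin F x \<Longrightarrow> \<tau> y \<in> F"
    "\<And>y. y \<in> adjoin F x \<Longrightarrow> y \<in> integral_closure A \<Longrightarrow> \<tau> y \<in> integral_closure A"
    "\<exists>y\<in>adjoin F x. \<tau> y \<noteq> 0"
proof -
  interpret e: field_hom to_ac by (rule field_hom_to_ac)
  interpret m: map_poly_idom_hom to_ac ..
  note F' = subfield_setD[OF F(1)]
  note pI = polys_over_intros[OF F']
  have xF: "x \<in> integral_closure F" using algebraic integral_closure_mono[OF F(2)] by blast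
  obtain f where f: "f \<in> polys_over F" "lead_coeff f = 1" "poly f x = 0"
    and min: "\<And>g. g \<in> polys_over F \<Longrightarrow> poly g x = 0 \<Longrightarrow> \<exists>q\<in>polys_over F. g = q * f"
    using minimal_polynomial_exists[OF F(1) xF] by blast
  define m where "m = degree f"
  have "m > 0"
  proof (rule gr0I)
    assume "m = 0"
    then have "f = [:lead_coeff f:]" by (metis degree_0_id m_def)
    then show False using f(2,3) by simp
  qed
  have small: "g = 0" if g: "g \<in> polys_over F" "poly g x = 0" "degree g < m" for g
  proof (rule ccontr)
    assume "g \<noteq> 0"
    from min[OF g(1,2)] obtain q where "g = q * f" by blast
    with \<open>g \<noteq> 0\<close> have "degree g = degree q + m" by (auto simp: degree_mult_eq m_def)
    with g(3) show False by simp
  qed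
  have "\<exists>g. g \<in> polys_over F \<and> degree g < m \<and> poly g x = y" if "y \<in> adjoin F x" for y
  proof -
    from that obtain h where h: "h \<in> polys_over F" "y = poly h x" by (auto simp: adjoin_def)
    obtain q r where "r \<in> polys_over F" "h = q * f + r" "r = 0 \<or> degree r < degree f"
      using polys_over_div_monic[OF F' f(1,2) h(1)] by blast
    with h f(3) \<open>m > 0\<close> show ?thesis by (intro exI[of _ r]) (auto simp: m_def)
  qed
  \<comment> \<open>\<open>G y\<close> collects the coordinates of \<open>y\<close> in the power
    basis 1, x, ..., x^(m-1) over \<open>F\<close>.\<close>
  then obtain G where G: "\<And>y. y \<in> adjoin F x \<Longrightarrow> G y \<in> polys_over F"
    "\<And>y. y \<in> adjoin F x \<Longrightarrow> degree (G y) < m" "\<And>y. y \<in> adjoin F x \<Longrightarrow> poly (G y) x = y"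
    by metis
  have G_eq: "G (poly g x) = g" if "g \<in> polys_over F" "degree g < m" for g
  proof -
    have "poly g x \<in> adjoin F x" using that by (auto simp: adjoin_def)
    then have "G (poly g x) - g = 0"
      using that G by (intro small pI degree_diff_less) auto
    then show ?thesis by simp
  qed
  have G_add: "G (y + z) = G y + G z" if "y \<in> adjoin F x" "z \<in> adjoin F x" for y z
    using G_eq[of "G y + G z"] that G by (simp add: pI degree_add_less)
  have G_mult: "G (c * y) = smult c (G y)" if "c \<in> F" "y \<in> adjoin F x" for c y
    using G_eq[OF polys_over_smult[OF F' that(1) G(1)[OF that(2)]]
        le_less_trans[OF degree_smult_le G(2)[OF that(2)]]] G(3)[OF that(2)] by simp
  \<comment> \<open>\<open>f\<close> divides a polynomial with a simple root at \<open>x\<close>, so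
    that root is simple for \<open>f\<close> too.\<close>
  have f'x: "poly (pderiv f) x \<noteq> 0"
  proof
    assume f'x: "poly (pderiv f) x = 0"
    obtain p where p: "p \<in> polys_over (fractions A)" "poly p x = 0" "poly (pderiv p) x \<noteq> 0"
      using separable by blast
    have "p \<in> polys_over F" using p(1) F(2) by (auto simp: polys_over_def)
    then obtain q where "p = q * f" using min p(2) by blast
    then show False using p(3) f'x f(3) by (simp add: pderiv_mult)
  qed
  have f'F: "pderiv f \<in> polys_over F"
    using f(1) by (auto simp: polys_over_def coeff_pderiv of_nat_Suc simp del: of_nat_Suc
        intro!: subring_mult[OF F'] subring_of_nat[OF F'])
  have field: "subfield_set (adjoin F x)" by (rule subfield_set_adjoin[OF F(1) xF])
  have "poly (pderiv f) x \<in> adjoin F x" using f'F by (auto simp: adjoin_def)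
  then have "inverse (poly (pderiv f) x) \<in> adjoin F x" using field by (auto simp: subfield_set_def)
  then obtain w where w: "w \<in> polys_over F" "poly w x = inverse (poly (pderiv f) x)"
    by (auto simp: adjoin_def)
  \<comment> \<open>\<open>w\<close> represents 1/f'(x). The factor \<open>D\<close> makes its
    coefficients integral, which is what makes \<open>\<tau>\<close> preserve integrality.\<close>
  obtain D where D: "D \<in> A" "D \<noteq> 0" "\<forall>i\<in>{..degree w}. D * coeff w i \<in> integral_closure A"
    using common_denominator[of "{..degree w}" "coeff w"] by blast
  define \<tau> where "\<tau> y = D * coeff (G y) (m - 1)" for y
  have DF: "D \<in> F" using D(1) F(2) subset_fractions[OF order] by blast
  define \<Omega> where "\<Omega> = integral_closure (to_ac ` A)"
  have "unital_subring (to_ac ` A)"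
  proof (rule unital_subringI)
    show "1 \<in> to_ac ` A" using subring_one[OF order] by (force intro: image_eqI[of _ _ 1])
    fix y z assume "y \<in> to_ac ` A" "z \<in> to_ac ` A"
    then obtain a b where "y = to_ac a" "z = to_ac b" "a \<in> A" "b \<in> A" by blast
    then show "y - z \<in> to_ac ` A" "y * z \<in> to_ac ` A"
      using subring_diff[OF order, of a b] subring_mult[OF order, of a b]
      by (metis imageI to_ac_diff, metis imageI to_ac_mult)
  qed
  then have \<Omega>: "unital_subring \<Omega>" unfolding \<Omega>_def by (rule unital_subring_integral_closure)
  let ?f = "map_poly to_ac f"
  \<comment> \<open>The relation w f' = 1 holds modulo \<open>f\<close>, hence at every conjugate
    \<open>s\<close> of \<open>x\<close>. In particular all roots of \<open>?f\<close> are
    simple.\<close>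
  have inv_f': "poly (map_poly to_ac w) s * poly (pderiv ?f) s = 1" if s: "poly ?f s = 0" for s
  proof -
    have "poly (w * pderiv f - 1) x = 0" using w(2) f'x by simp
    moreover have "w * pderiv f - 1 \<in> polys_over F" using w(1) f'F by (simp add: pI)
    ultimately obtain q where "w * pderiv f - 1 = q * f" using min by blast
    then have "map_poly to_ac (w * pderiv f - 1) = map_poly to_ac (q * f)" by simp
    then have "map_poly to_ac w * pderiv ?f - 1 = map_poly to_ac q * ?f"
      by (simp add: hom_distribs)
    from arg_cong[OF this, of "\<lambda>p. poly p s"] show ?thesis using s by simp
  qed
  have "lead_coeff ?f = 1" using f(2) by simp
  moreover have "poly (pderiv ?f) s \<noteq> 0" if "poly ?f s = 0" for s
    using inv_f'[OF that] by auto
  ultimately obtain S where S: "finite S" "?f = (\<Prod>s\<in>S. [:- s, 1:])"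
    by (rule monic_separable_splits)
  have root: "poly ?f s = 0" if "s \<in> S" for s
    using that S by (auto simp: poly_prod intro!: prod_zero bexI[of _ s])
  have card: "card S = m"
  proof -
    have "degree ?f = card S" unfolding S(2) using S(1) by (subst degree_prod_eq_sum_degree) auto
    then show ?thesis by (simp add: m_def)
  qed
  \<comment> \<open>By \<open>lagrange_top_coeff\<close> the image of \<open>\<tau> y\<close> is the
    sum over the roots s of g(s) times (D w)(s), where g is \<open>G y\<close>. Both factors are
    integral.\<close>
  have \<tau>_integral: "\<tau> y \<in> integral_closure A" if y: "y \<in> adjoin F x" "y \<in> integral_closure A" for y
  proof -
    let ?g = "map_poly to_ac (G y)"
    let ?w = "map_poly to_ac (smult D w)"
    have "degree ?g < card S" using G(2)[OF y(1)] card by simp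
    then have "coeff ?g (card S - 1) = (\<Sum>s\<in>S. poly ?g s / poly (pderiv ?f) s)"
      by (rule lagrange_top_coeff[OF S])
    then have "to_ac (\<tau> y) = (\<Sum>s\<in>S. to_ac D * (poly ?g s / poly (pderiv ?f) s))"
      by (simp add: \<tau>_def card sum_distrib_left)
    also have "\<dots> = (\<Sum>s\<in>S. poly ?g s * poly ?w s)"
    proof (rule sum.cong)
      fix s assume "s \<in> S"
      then have "inverse (poly (pderiv ?f) s) = poly (map_poly to_ac w) s"
        using inv_f'[OF root] by (metis inverse_unique mult.commute)
      then show "to_ac D * (poly ?g s / poly (pderiv ?f) s) = poly ?g s * poly ?w s"
        by (simp add: divide_inverse hom_distribs)
    qed simp
    also have "\<dots> \<in> \<Omega>"
    proof (intro subring_sum[OF \<Omega>] subring_mult[OF \<Omega>])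
      fix s assume s: "s \<in> S"
      show "poly ?g s \<in> \<Omega>" unfolding \<Omega>_def
        using conjugate_integral[OF F f(1,3) min G(1)[OF y(1)] _ root[OF s]] G(3)[OF y(1)] y(2)
        by simp
      \<comment> \<open>The polynomial X, whose value at \<open>x\<close> is integral, shows that
        the conjugate \<open>s\<close> is integral.\<close>
      have "poly (map_poly to_ac [:0, 1:]) s \<in> \<Omega>" unfolding \<Omega>_def
        using conjugate_integral[OF F f(1,3) min polys_over_X[OF F'] _ root[OF s]] x by simp
      then have "s \<in> \<Omega>" by simp
      moreover have "coeff (smult D w) i \<in> integral_closure A" for i
        using D(3) subring_zero[OF order_integral] by (cases "i \<le> degree w") (auto simp: coeff_eq_0)
      then have "?w \<in> polys_over \<Omega>"
        unfolding polys_over_def \<Omega>_def mem_Collect_eq e.coeff_map_poly_hom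
          integral_closure_hom[OF field_hom_to_ac] by blast
      ultimately show "poly ?w s \<in> \<Omega>" using poly_in_subring[OF \<Omega>] by blast
    qed
    finally show ?thesis unfolding \<Omega>_def integral_closure_hom[OF field_hom_to_ac] .
  qed
  show thesis
  proof (rule that)
    show "\<tau> (y + z) = \<tau> y + \<tau> z" if "y \<in> adjoin F x" "z \<in> adjoin F x" for y z
      using G_add[OF that] by (simp add: \<tau>_def distrib_left)
    show "\<tau> (c * y) = c * \<tau> y" if "c \<in> F" "y \<in> adjoin F x" for c y
      using G_mult[OF that] by (simp add: \<tau>_def)
    show "\<tau> y \<in> F" if "y \<in> adjoin F x" for y
      using G(1)[OF that] DF by (auto simp: \<tau>_def polys_over_def intro: subring_mult[OF F'])
    show "\<tau> y \<in> integral_closure A" if "y \<in> adjoin F x" "y \<in> integral_closure A" for y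
      by (rule \<tau>_integral[OF that])
    \<comment> \<open>The power x^(m-1) has top coordinate 1, so \<open>\<tau>\<close> takes the
      nonzero value \<open>D\<close> there.\<close>
    have X: "monom 1 (m - 1) \<in> polys_over F" by (rule polys_over_monom[OF F' subring_one[OF F']])
    have "G (poly (monom 1 (m - 1)) x) = monom 1 (m - 1)"
      using \<open>m > 0\<close> by (intro G_eq[OF X]) (simp add: degree_monom_eq)
    then have "\<tau> (poly (monom 1 (m - 1)) x) \<noteq> 0" using D(2) by (simp add: \<tau>_def)
    moreover have "poly (monom 1 (m - 1)) x \<in> adjoin F x" using X unfolding adjoin_def by blast
    ultimately show "\<exists>y\<in>adjoin F x. \<tau> y \<noteq> 0" by blast
  qed
qed

section \<open>Functionals on the whole field, dual bases and denominators of linear maps\<close>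

text \<open>An abstract substitute for the trace. It is a total function constrained only on
  \<open>F\<close>, so that the domain can grow along a tower of fields.\<close>

definition integral_functional :: "'a set \<Rightarrow> ('a \<Rightarrow> 'a) \<Rightarrow> bool" where
  "integral_functional F \<phi> \<longleftrightarrow>
     (\<forall>y\<in>F. \<forall>z\<in>F. \<phi> (y + z) = \<phi> y + \<phi> z) \<and>
     (\<forall>c\<in>fractions A. \<forall>y\<in>F. \<phi> (c * y) = c * \<phi> y) \<and>
     (\<forall>y\<in>F. \<phi> y \<in> fractions A) \<and>
     (\<forall>y\<in>F \<inter> integral_closure A. \<phi> y \<in> A) \<and>
     (\<exists>y\<in>F. \<phi> y \<noteq> 0)"

text \<open>Once \<open>x\<close> is scaled to be integral, \<open>integral_functional_step\<close>
  gives an \<open>F\<close>-linear map from the larger field to \<open>F\<close>, which is composed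
  with \<open>\<phi>\<close>.\<close>

lemma integral_functional_adjoin:
  assumes F: "subfield_set F" "fractions A \<subseteq> F" and \<phi>: "integral_functional F \<phi>"
  shows "\<exists>E \<psi>. subfield_set E \<and> F \<subseteq> E \<and> x \<in> E \<and> integral_functional E \<psi>"
proof -
  note F' = subfield_setD[OF F(1)]
  obtain d where d: "d \<in> A" "d \<noteq> 0" "d * x \<in> integral_closure A" using denominator by blast
  define E where "E = adjoin F (d * x)"
  obtain \<tau> where \<tau>:
    "\<And>y z. y \<in> E \<Longrightarrow> z \<in> E \<Longrightarrow> \<tau> (y + z) = \<tau> y + \<tau> z"
    "\<And>c y. c \<in> F \<Longrightarrow> y \<in> E \<Longrightarrow> \<tau> (c * y) = c * \<tau> y"
    "\<And>y. y \<in> E \<Longrightarrow> \<tau> y \<in> F"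
    "\<And>y. y \<in> E \<Longrightarrow> y \<in> integral_closure A \<Longrightarrow> \<tau> y \<in> integral_closure A"
    "\<exists>y\<in>E. \<tau> y \<noteq> 0"
    unfolding E_def using integral_functional_step[OF F d(3)] by blast
  have "d * x \<in> integral_closure F" using algebraic integral_closure_mono[OF F(2)] by blast
  then have E: "subfield_set E" unfolding E_def by (rule subfield_set_adjoin[OF F(1)])
  have FE: "F \<subseteq> E" "d * x \<in> E" unfolding E_def by (rule adjoin_contains[OF F'])+
  have "d \<in> E" using d(1) subset_fractions[OF order] F(2) FE(1) by blast
  then have "d * x / d \<in> E" using subfield_set_divide[OF E FE(2)] by blast
  then have "x \<in> E" using d(2) by simp
  \<comment> \<open>A nonzero \<open>F\<close>-linear \<open>\<tau>\<close> attains every value in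
    \<open>F\<close>, in particular one at which \<open>\<phi>\<close> does not vanish.\<close>
  have "\<exists>y\<in>E. \<phi> (\<tau> y) \<noteq> 0"
  proof -
    obtain u where u: "u \<in> F" "\<phi> u \<noteq> 0" using \<phi> by (auto simp: integral_functional_def)
    obtain y where y: "y \<in> E" "\<tau> y \<noteq> 0" using \<tau>(5) by blast
    have c: "u / \<tau> y \<in> F" using subfield_set_divide[OF F(1) u(1) \<tau>(3)[OF y(1)]] .
    then have "\<tau> (u / \<tau> y * y) = u" using \<tau>(2)[OF c y(1)] y(2) by simp
    moreover have "u / \<tau> y * y \<in> E"
      using c FE(1) y(1) by (intro subring_mult[OF subfield_setD[OF E]]) auto
    ultimately show ?thesis using u(2) by metis
  qed
  then have "integral_functional E (\<lambda>y. \<phi> (\<tau> y))"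
    using \<phi> \<tau>(1-4) F(2) unfolding integral_functional_def by (auto simp: subset_iff)
  with E FE(1) \<open>x \<in> E\<close> show ?thesis by blast
qed

lemma integral_functional_exists: "\<exists>\<phi>. integral_functional UNIV \<phi>"
proof -
  obtain T where T: "finite T" "rspan (fractions A) T = UNIV"
    using finite_over_fractions by (auto simp: finite_over_iff_rspan)
  have "\<exists>E \<phi>. subfield_set E \<and> fractions A \<subseteq> E \<and> T \<subseteq> E \<and> integral_functional E \<phi>"
    using T(1)
  proof (induction T rule: finite_induct)
    case empty
    have "1 \<in> fractions A" using subring_one[OF subfield_setD[OF subfield_fractions]] .
    \<comment> \<open>The tower starts with the identity on the fraction field, which maps integral
      elements into \<open>A\<close> because \<open>A\<close> is integrally closed.\<close>
    then have "integral_functional (fractions A) (\<lambda>y. y)"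
      using integrally_closed by (auto simp: integral_functional_def intro!: bexI[of _ 1])
    then show ?case using subfield_fractions by blast
  next
    case (insert x T)
    then obtain E \<phi> where E: "subfield_set E" "fractions A \<subseteq> E" "T \<subseteq> E" "integral_functional E \<phi>"
      by blast
    from integral_functional_adjoin[OF E(1,2,4), of x] E(2,3) show ?case
      by (meson insert_subset subset_trans)
  qed
  then obtain E \<phi> where E: "subfield_set E" "fractions A \<subseteq> E" "T \<subseteq> E" "integral_functional E \<phi>"
    by blast
  note E' = subfield_setD[OF E(1)]
  have "rspan (fractions A) T \<subseteq> E"
    using E by (intro rspan_least[OF subfield_setD[OF subfield_fractions]])
      (auto intro: subring_zero[OF E'] subring_add[OF E'] subring_mult[OF E'])
  then have "E = UNIV" using T(2) by blast
  with E(4) show ?thesis by blast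
qed

text \<open>Nondegeneracy of the pairing of a and y by \<phi>(a y), proved by elimination on the
  generators.\<close>

lemma functional_separates:
  assumes \<phi>: "integral_functional UNIV \<phi>" and "finite S" "v \<notin> rspan (fractions A) S"
  shows "\<exists>a. (\<forall>s\<in>S. \<phi> (a * s) = 0) \<and> \<phi> (a * v) \<noteq> 0"
  using assms(2,3)
proof (induction S arbitrary: v rule: finite_induct)
  case empty
  then have "v \<noteq> 0" by (auto simp: rspan_def)
  obtain y where "\<phi> y \<noteq> 0" using \<phi> by (auto simp: integral_functional_def)
  then show ?case using \<open>v \<noteq> 0\<close> by (intro exI[of _ "y / v"]) simp
next
  case (insert s S)
  note K = subfield_setD[OF subfield_fractions]
  have add: "\<phi> (y + z) = \<phi> y + \<phi> z" and scale: "c \<in> fractions A \<Longrightarrow> \<phi> (c * y) = c * \<phi> y"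
    and val: "\<phi> y \<in> fractions A" for y z c
    using \<phi> by (auto simp: integral_functional_def)
  have vS: "v \<notin> rspan (fractions A) S"
    using insert.prems rspan_mono[OF K, of "insert s S" S] insert.hyps by blast
  show ?case
  proof (cases "\<exists>b. (\<forall>t\<in>S. \<phi> (b * t) = 0) \<and> \<phi> (b * s) \<noteq> 0")
    \<comment> \<open>Every multiplier that kills \<open>S\<close> then kills \<open>s\<close> as
      well.\<close>
    case False
    with insert.IH[OF vS] show ?thesis by blast
  next
    case True
    then obtain b where b: "\<forall>t\<in>S. \<phi> (b * t) = 0" "\<phi> (b * s) \<noteq> 0" by blast
    \<comment> \<open>Subtracting \<open>c * s\<close> makes \<open>v\<close> orthogonal to
      \<open>b\<close>. The multiplier \<open>a\<close> found for the difference is then corrected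
      by \<open>e * b\<close>, so that it also kills \<open>s\<close>.\<close>
    define c where "c = \<phi> (b * v) / \<phi> (b * s)"
    have c: "c \<in> fractions A" unfolding c_def by (rule subfield_set_divide[OF subfield_fractions val val])
    have diff: "\<phi> (y - z) = \<phi> y - \<phi> z" for y z using add[of "y - z" z] by simp
    have "v - c * s \<notin> rspan (fractions A) S"
    proof
      assume "v - c * s \<in> rspan (fractions A) S"
      then have "v - c * s \<in> rspan (fractions A) (insert s S)"
        using rspan_mono[OF K, of "insert s S" S] insert.hyps by blast
      moreover have "c * s \<in> rspan (fractions A) (insert s S)"
        using insert.hyps by (intro rspan_mult[OF K c] rspan_base[OF K]) auto
      ultimately have "v - c * s + c * s \<in> rspan (fractions A) (insert s S)" by (rule rspan_add[OF K])
      with insert.prems show False by simp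
    qed
    from insert.IH[OF this] obtain a where a: "\<forall>t\<in>S. \<phi> (a * t) = 0" "\<phi> (a * (v - c * s)) \<noteq> 0"
      by blast
    define e where "e = \<phi> (a * s) / \<phi> (b * s)"
    have e: "e \<in> fractions A" unfolding e_def by (rule subfield_set_divide[OF subfield_fractions val val])
    have *: "\<phi> ((a - e * b) * t) = \<phi> (a * t) - e * \<phi> (b * t)" for t
      using diff[of "a * t" "e * (b * t)"] scale[OF e, of "b * t"]
      by (simp add: left_diff_distrib mult.assoc)
    have "\<phi> (a * (v - c * s)) = \<phi> (a * v) - c * \<phi> (a * s)"
      using diff[of "a * v" "c * (a * s)"] scale[OF c, of "a * s"]
      by (simp add: right_diff_distrib mult.left_commute)
    also have "\<dots> = \<phi> ((a - e * b) * v)" unfolding * by (simp add: c_def e_def)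
    finally have "\<phi> ((a - e * b) * v) \<noteq> 0" using a(2) by simp
    moreover have "\<forall>t\<in>insert s S. \<phi> ((a - e * b) * t) = 0"
      unfolding * using a(1) b by (simp add: e_def)
    ultimately show ?thesis by blast
  qed
qed

text \<open>A generating set of least size is independent, so each of its elements is separated from
  the span of the others by some multiplier, which is scaled to give the value 1.\<close>

lemma dual_basis_exists:
  assumes \<phi>: "integral_functional UNIV \<phi>"
  obtains T a where "finite T" "\<And>y. y = (\<Sum>t\<in>T. \<phi> (a t * y) * t)"
proof -
  note K = subfield_setD[OF subfield_fractions]
  have add: "\<phi> (y + z) = \<phi> y + \<phi> z" and scale: "c \<in> fractions A \<Longrightarrow> \<phi> (c * y) = c * \<phi> y"
    and val: "\<phi> y \<in> fractions A" for y z c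
    using \<phi> by (auto simp: integral_functional_def)
  have zero: "\<phi> 0 = 0" using add[of 0 0] by (metis add_cancel_right_right add.right_neutral)
  have sum: "\<phi> (\<Sum>i\<in>I. f i) = (\<Sum>i\<in>I. \<phi> (f i))" for I and f :: "'a \<Rightarrow> 'a"
    by (induction I rule: infinite_finite_induct) (simp_all add: zero add)
  define P where "P T \<longleftrightarrow> finite T \<and> rspan (fractions A) T = UNIV" for T
  obtain T0 where "P T0" using finite_over_fractions by (auto simp: finite_over_iff_rspan P_def)
  define T where "T = arg_min card P"
  have T: "finite T" "rspan (fractions A) T = UNIV" and min: "\<And>U. P U \<Longrightarrow> card T \<le> card U"
    using arg_min_nat_lemma[of P T0 card, OF \<open>P T0\<close>] by (auto simp: T_def P_def)
  have "\<exists>a. (\<forall>s\<in>T - {t}. \<phi> (a * s) = 0) \<and> \<phi> (a * t) = 1" if t: "t \<in> T" for t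
  proof -
    have "t \<notin> rspan (fractions A) (T - {t})"
    proof
      assume "t \<in> rspan (fractions A) (T - {t})"
      moreover have "T - {t} \<subseteq> rspan (fractions A) (T - {t})" using T(1) rspan_base[OF K] by blast
      ultimately have "T \<subseteq> rspan (fractions A) (T - {t})" by blast
      then have "rspan (fractions A) T \<subseteq> rspan (fractions A) (T - {t})"
        by (rule rspan_least[OF K _ rspan_zero[OF K] rspan_add[OF K] rspan_mult[OF K]])
      then have "P (T - {t})" using T by (auto simp: P_def)
      from min[OF this] have "card T \<le> card (T - {t})" .
      with t T(1) show False by (metis card_Diff1_less not_le)
    qed
    then obtain a where a: "\<forall>s\<in>T - {t}. \<phi> (a * s) = 0" "\<phi> (a * t) \<noteq> 0"
      using functional_separates[OF \<phi>, of "T - {t}" t] T(1) by blast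
    define c where "c = inverse (\<phi> (a * t))"
    have c: "c \<in> fractions A" using subfield_fractions val by (auto simp: c_def subfield_set_def)
    have "\<phi> (c * a * s) = c * \<phi> (a * s)" for s using scale[OF c, of "a * s"] by (simp add: mult.assoc)
    then show ?thesis using a by (intro exI[of _ "c * a"]) (simp add: c_def)
  qed
  then obtain a where a: "\<And>t s. t \<in> T \<Longrightarrow> s \<in> T \<Longrightarrow> s \<noteq> t \<Longrightarrow> \<phi> (a t * s) = 0"
    "\<And>t. t \<in> T \<Longrightarrow> \<phi> (a t * t) = 1" by (metis Diff_iff empty_iff insert_iff)
  have "y = (\<Sum>t\<in>T. \<phi> (a t * y) * t)" for y
  proof -
    obtain c where c: "\<forall>s\<in>T. c s \<in> fractions A" "y = (\<Sum>s\<in>T. c s * s)"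
      using T(2) unfolding rspan_def by blast
    have "\<phi> (a t * y) = c t" if t: "t \<in> T" for t
    proof -
      have "a t * y = (\<Sum>s\<in>T. c s * (a t * s))"
        by (simp add: c(2) sum_distrib_left mult.left_commute)
      then have "\<phi> (a t * y) = (\<Sum>s\<in>T. \<phi> (c s * (a t * s)))" by (simp only: sum)
      also have "\<dots> = (\<Sum>s\<in>T. if s = t then c t else 0)"
        using c(1) a t by (intro sum.cong) (auto simp: scale)
      finally show ?thesis using t T(1) by simp
    qed
    then show ?thesis using c(2) by (simp cong: sum.cong)
  qed
  with T(1) that show thesis by blast
qed

text \<open>A dual basis expresses f(b) through finitely many values f(t), with coefficients of
  bounded denominator. Applied to the action of \<open>h\<close>, this yields a nonzero multiple of
  \<open>h\<close> in the associated order.\<close>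

lemma linear_map_denominator:
  assumes B: "fractional_ideal (integral_closure A) B"
    and add: "\<And>y z. f (y + z) = f y + f z"
    and scale: "\<And>c y. c \<in> fractions A \<Longrightarrow> f (c * y) = c * f y"
  shows "\<exists>d\<in>A. d \<noteq> 0 \<and> (\<forall>b\<in>B. d * f b \<in> B)"
proof -
  obtain \<phi> where \<phi>: "integral_functional UNIV \<phi>" using integral_functional_exists by blast
  then have val: "\<phi> y \<in> fractions A" and int: "y \<in> integral_closure A \<Longrightarrow> \<phi> y \<in> A"
    and scale\<phi>: "c \<in> fractions A \<Longrightarrow> \<phi> (c * y) = c * \<phi> y" for y c
    by (auto simp: integral_functional_def)
  obtain T a where T: "finite T" "\<And>y. y = (\<Sum>t\<in>T. \<phi> (a t * y) * t)"
    using dual_basis_exists[OF \<phi>] by metis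
  have B0: "0 \<in> B" and Badd: "x \<in> B \<Longrightarrow> y \<in> B \<Longrightarrow> x + y \<in> B"
    and Bmult: "r \<in> integral_closure A \<Longrightarrow> x \<in> B \<Longrightarrow> r * x \<in> B" for x y r
    using B by (auto simp: fractional_ideal_def)
  obtain d0 where d0: "d0 \<noteq> 0" "\<And>x. x \<in> B \<Longrightarrow> d0 * x \<in> integral_closure A"
    using B unfolding fractional_ideal_def by blast
  obtain b0 where b0: "b0 \<in> B" "b0 \<noteq> 0" using B by (auto simp: fractional_ideal_def)
  \<comment> \<open>Since \<open>d0 * b\<close> is integral, this choice makes
    \<open>d1 * (a t * b)\<close> integral for every \<open>b\<close> in \<open>B\<close>.\<close>
  obtain d1 where d1: "d1 \<in> A" "d1 \<noteq> 0" "\<forall>t\<in>T. d1 * (a t / d0) \<in> integral_closure A"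
    using common_denominator[OF T(1), of "\<lambda>t. a t / d0"] by blast
  \<comment> \<open>Multiplying back by \<open>b0\<close> puts \<open>d2 * f t\<close> into
    \<open>B\<close>.\<close>
  obtain d2 where d2: "d2 \<in> A" "d2 \<noteq> 0" "\<forall>t\<in>T. d2 * (f t / b0) \<in> integral_closure A"
    using common_denominator[OF T(1), of "\<lambda>t. f t / b0"] by blast
  have f0: "f 0 = 0" using add[of 0 0] by (metis add_cancel_right_right add.right_neutral)
  have fsum: "f (\<Sum>i\<in>I. g i) = (\<Sum>i\<in>I. f (g i))" for I and g :: "'a \<Rightarrow> 'a"
    by (induction I rule: infinite_finite_induct) (simp_all add: f0 add)
  have Bsum: "(\<And>i. i \<in> I \<Longrightarrow> g i \<in> B) \<Longrightarrow> sum g I \<in> B" for I and g :: "'a \<Rightarrow> 'a"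
    by (induction I rule: infinite_finite_induct) (auto intro: B0 Badd)
  have "d1 * d2 * f b \<in> B" if b: "b \<in> B" for b
  proof -
    have "f b = (\<Sum>t\<in>T. \<phi> (a t * b) * f t)"
      using arg_cong[OF T(2)[of b], of f] by (simp add: fsum scale[OF val])
    then have "d1 * d2 * f b = (\<Sum>t\<in>T. (d1 * \<phi> (a t * b)) * (d2 * f t))"
      by (simp add: sum_distrib_left mult_ac)
    also have "\<dots> \<in> B"
    proof (rule Bsum, rule Bmult)
      fix t assume t: "t \<in> T"
      have "d1 * (a t / d0) * (d0 * b) \<in> integral_closure A"
        using d1(3) t d0(2)[OF b] by (blast intro: subring_mult[OF order_integral])
      moreover have "d1 * (a t / d0) * (d0 * b) = d1 * (a t * b)" using d0(1) by simp
      ultimately have "\<phi> (d1 * (a t * b)) \<in> A" using int by metis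
      moreover have "d1 \<in> fractions A" using d1(1) subset_fractions[OF order] by blast
      ultimately show "d1 * \<phi> (a t * b) \<in> integral_closure A"
        using scale\<phi> order_subset by auto
      have "d2 * (f t / b0) * b0 \<in> B" using Bmult d2(3) t b0(1) by blast
      then show "d2 * f t \<in> B" using b0(2) by simp
    qed
    finally show ?thesis .
  qed
  moreover have "d1 * d2 \<in> A" "d1 * d2 \<noteq> 0" using d1 d2 by (auto intro: subring_mult[OF order])
  ultimately show ?thesis by blast
qed

end

subsection \<open>Rings of integers\<close>

lemma prime_poly_ring_eq_adjoin: "prime_poly_ring t = adjoin \<int> t"
  unfolding prime_poly_ring_def adjoin_def polys_over_def by blast

lemma unital_subring_Ints: "unital_subring (\<int> :: 'a::comm_ring_1 set)"
  by (rule unital_subringI) auto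

text \<open>Covers number fields and function fields together. Each element is algebraic over the
  fraction field of \<open>A\<close>, so some nonzero multiple of it is integral.\<close>

lemma integral_closure_order:
  assumes A: "unital_subring A" and fin: "finite_over (fractions A)"
  defines "R \<equiv> integral_closure A"
  shows "unital_subring R" "integral_closure R = R" "fractions R = UNIV"
proof -
  show R: "unital_subring R" unfolding R_def by (rule unital_subring_integral_closure[OF A])
  show "integral_closure R = R" unfolding R_def by (rule integral_closure_idem[OF A])
  have "x \<in> fractions R" for x
  proof -
    have "x \<in> integral_closure (fractions A)"
      using finite_over_algebraic[OF subfield_setD[OF subfield_set_fractions[OF A]] fin] by simp
    then obtain d where d: "d \<in> A" "d \<noteq> 0" "d * x \<in> R"
      using integral_denominator[OF A] unfolding R_def by blast
    moreover have "d \<in> R" using d(1) subset_integral_closure[OF A] unfolding R_def by blast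
    moreover have "x = d * x / d" using d(2) by simp
    ultimately show ?thesis unfolding fractions_def by blast
  qed
  then show "fractions R = UNIV" by blast
qed

section \<open>Discrete valuation rings\<close>

context
  fixes v :: "'k::field \<Rightarrow> int"
  assumes v: "normalized_discrete_valuation v"
begin

lemma val_mult: "x \<noteq> 0 \<Longrightarrow> y \<noteq> 0 \<Longrightarrow> v (x * y) = v x + v y"
  using v by (auto simp: normalized_discrete_valuation_def)

lemma val_one: "v 1 = 0"
  using val_mult[of 1 1] by simp

lemma val_uminus: "v (- x) = v x"
proof (cases "x = 0")
  case False
  have "v (-1) + v (-1) = v 1" using val_mult[of "-1" "-1"] by simp
  then have "v (-1) = 0" by (simp add: val_one)
  then show ?thesis using val_mult[of "-1" x] False by simp
qed simp

lemma val_power: "x \<noteq> 0 \<Longrightarrow> v (x ^ n) = int n * v x"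
  by (induction n) (simp_all add: val_one val_mult algebra_simps)

lemma val_ge_add: "x \<in> val_ge v n \<Longrightarrow> y \<in> val_ge v n \<Longrightarrow> x + y \<in> val_ge v n"
proof -
  assume "x \<in> val_ge v n" "y \<in> val_ge v n"
  moreover have "min (v x) (v y) \<le> v (x + y)" if "x \<noteq> 0" "y \<noteq> 0" "x + y \<noteq> 0"
    using that v by (auto simp: normalized_discrete_valuation_def)
  ultimately show ?thesis unfolding val_ge_def by fastforce
qed

lemma val_ge_sum: "(\<And>i. i \<in> I \<Longrightarrow> f i \<in> val_ge v n) \<Longrightarrow> sum f I \<in> val_ge v n"
  by (induction I rule: infinite_finite_induct) (simp_all add: val_ge_add, simp_all add: val_ge_def)

lemma val_ge_mult: "x \<in> val_ge v m \<Longrightarrow> y \<in> val_ge v n \<Longrightarrow> x * y \<in> val_ge v (m + n)"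
  by (cases "x = 0 \<or> y = 0") (auto simp: val_ge_def val_mult)

lemma unital_subring_val_ge: "unital_subring (val_ge v 0)"
proof (rule unital_subringI)
  fix x y assume xy: "x \<in> val_ge v 0" "y \<in> val_ge v 0"
  then show "x * y \<in> val_ge v 0" using val_ge_mult[of x 0 y 0] by simp
  have "- y \<in> val_ge v 0" using xy by (simp add: val_ge_def val_uminus)
  then show "x - y \<in> val_ge v 0" using val_ge_add[OF xy(1)] by force
qed (simp add: val_ge_def val_one)

lemma fractions_val_ge: "fractions (val_ge v 0) = UNIV"
proof -
  have "x \<in> fractions (val_ge v 0)" for x
  proof (cases "x \<in> val_ge v 0")
    case True
    then show ?thesis using subset_fractions[OF unital_subring_val_ge] by blast
  next
    case False
    then have x: "x \<noteq> 0" "v x < 0" by (auto simp: val_ge_def)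
    have "v (inverse x) = - v x" using val_mult[of x "inverse x"] x(1) by (simp add: val_one)
    then have "inverse x \<in> val_ge v 0" "1 \<in> val_ge v 0" "inverse x \<noteq> 0" "x = 1 / inverse x"
      using x by (simp_all add: val_ge_def val_one divide_inverse)
    then show ?thesis unfolding fractions_def by blast
  qed
  then show ?thesis by blast
qed

text \<open>If \<open>v x < 0\<close> then the leading term of a monic integral equation for \<open>x\<close> has strictly
  smaller valuation than all the others.\<close>

lemma integral_closure_val_ge: "integral_closure (val_ge v 0) \<subseteq> val_ge v 0"
proof
  fix x assume "x \<in> integral_closure (val_ge v 0)"
  then obtain p where p: "\<And>i. coeff p i \<in> val_ge v 0" "lead_coeff p = 1" "poly p x = 0"
    by (auto simp: integral_closure_def)
  show "x \<in> val_ge v 0"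
  proof (rule ccontr)
    assume "x \<notin> val_ge v 0"
    then have x: "x \<noteq> 0" "v x < 0" by (auto simp: val_ge_def)
    let ?n = "degree p"
    have "poly p x = (\<Sum>i<?n. coeff p i * x ^ i) + x ^ ?n"
      using p(2) by (simp add: poly_altdef lessThan_Suc_atMost[symmetric])
    then have eq: "x ^ ?n = - (\<Sum>i<?n. coeff p i * x ^ i)" using p(3) by (simp add: eq_neg_iff_add_eq_0 add.commute)
    have "coeff p i * x ^ i \<in> val_ge v ((int ?n - 1) * v x)" if "i < ?n" for i
    proof -
      have "(int ?n - 1) * v x \<le> int i * v x"
        using that x(2) by (intro mult_right_mono_neg) auto
      then have "x ^ i \<in> val_ge v ((int ?n - 1) * v x)" using x(1) by (simp add: val_ge_def val_power)
      from val_ge_mult[OF p(1) this] show ?thesis by simp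
    qed
    then have "(\<Sum>i<?n. coeff p i * x ^ i) \<in> val_ge v ((int ?n - 1) * v x)"
      by (intro val_ge_sum) auto
    then have "x ^ ?n \<in> val_ge v ((int ?n - 1) * v x)"
      unfolding eq by (simp add: val_ge_def val_uminus)
    then have "(int ?n - 1) * v x \<le> int ?n * v x" using x(1) by (simp add: val_ge_def val_power)
    with x(2) show False by (simp add: left_diff_distrib)
  qed
qed

end

text \<open>A ring of integers is either a valuation ring or the integral closure of a subring with
  finite extension above its fractions; the two cases are reduced to common properties here.\<close>

lemma ring_of_integers_properties:
  fixes R :: "'k::field set"
  assumes "ring_of_integers R"
  shows "unital_subring R" "integral_closure R \<subseteq> R" "fractions R = UNIV"
proof -
  consider (local) v where "normalized_discrete_valuation v" "R = val_ge v 0"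
    | (global) S where "unital_subring S" "finite_over (fractions S)" "R = integral_closure S"
    using assms unfolding ring_of_integers_def local_field_valuation_def prime_poly_ring_eq_adjoin
    using unital_subring_Ints unital_subring_adjoin[OF unital_subring_Ints] by blast
  then have "unital_subring R \<and> integral_closure R \<subseteq> R \<and> fractions R = UNIV"
  proof cases
    case local
    then show ?thesis
      using unital_subring_val_ge integral_closure_val_ge fractions_val_ge by blast
  next
    case global
    then show ?thesis using integral_closure_order by blast
  qed
  then show "unital_subring R" "integral_closure R \<subseteq> R" "fractions R = UNIV" by blast+
qed

text \<open>A nonzero polynomial \<open>d\<close> over \<open>K\<close> of least degree vanishing at
  \<open>x\<close> divides all others that vanish there. If it divided both \<open>p\<close> and its
  derivative it would be a unit, but a nonzero constant has no root.\<close>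

lemma coprime_pderiv_simple_root:
  fixes \<iota> :: "'k::field \<Rightarrow> 'l::field"
  assumes \<iota>: "field_hom \<iota>" and p: "coprime p (pderiv p)" "poly (map_poly \<iota> p) x = 0"
  shows "poly (map_poly \<iota> (pderiv p)) x \<noteq> 0"
proof
  interpret \<iota>: field_hom \<iota> by fact
  interpret m: map_poly_inj_idom_hom \<iota> ..
  assume p': "poly (map_poly \<iota> (pderiv p)) x = 0"
  define P where "P g \<longleftrightarrow> g \<noteq> 0 \<and> poly (map_poly \<iota> g) x = 0" for g
  have "p \<noteq> 0" using p(1) by auto
  then have "P p" using p(2) by (simp add: P_def)
  define d where "d = arg_min degree P"
  have d: "P d" "\<And>g. P g \<Longrightarrow> degree d \<le> degree g"
    using arg_min_nat_lemma[of P p degree, OF \<open>P p\<close>] by (auto simp: d_def)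
  have dvd: "d dvd g" if "poly (map_poly \<iota> g) x = 0" for g
  proof (rule ccontr)
    assume "\<not> d dvd g"
    then have r: "g mod d \<noteq> 0" by (simp add: dvd_eq_mod_eq_0)
    have "map_poly \<iota> g = map_poly \<iota> (g div d) * map_poly \<iota> d + map_poly \<iota> (g mod d)"
      by (simp flip: hom_distribs)
    then have "poly (map_poly \<iota> (g mod d)) x = 0" using that d(1) by (simp add: P_def)
    with r have "degree d \<le> degree (g mod d)" by (intro d(2)) (simp add: P_def)
    moreover have "degree (g mod d) < degree d"
      using degree_mod_less[of d g] d(1) r by (auto simp: P_def)
    ultimately show False by simp
  qed
  have "is_unit d" using p(1) dvd[OF p(2)] dvd[OF p'] by (rule coprime_common_divisor)
  then have "degree d = 0" "d \<noteq> 0" using d(1) by (simp_all add: is_unit_iff_degree P_def)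
  then obtain c where "d = [:c:]" "c \<noteq> 0" by (metis degree_eq_zeroE pCons_0_0)
  with d(1) show False by (simp add: P_def hom_distribs)
qed

text \<open>Integral closedness transfers along the injective map \<open>\<iota>\<close>, and
  coprimality with the derivative turns into a simple root in \<open>L\<close>.\<close>

lemma separable_order_image:
  fixes \<iota> :: "'k::field \<Rightarrow> 'l::field"
  assumes R: "ring_of_integers R" and sep: "finite_separable_extension \<iota>"
  shows "separable_order (\<iota> ` R)" "fractions (\<iota> ` R) = range \<iota>"
proof -
  note R = ring_of_integers_properties[OF R]
  have \<iota>: "field_hom \<iota>" using sep by (simp add: finite_separable_extension_def)
  interpret \<iota>: field_hom \<iota> by fact
  have "fractions (\<iota> ` R) = \<iota> ` fractions R"
  proof -
    have div: "\<iota> (a / b) = \<iota> a / \<iota> b" for a b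
      by (cases "b = 0") (simp_all add: field_simps flip: \<iota>.hom_mult)
    have "fractions (\<iota> ` R) = {\<iota> a / \<iota> b | a b. a \<in> R \<and> b \<in> R \<and> b \<noteq> 0}"
      unfolding fractions_def by (force simp: \<iota>.hom_0_iff)
    then show ?thesis unfolding fractions_def div[symmetric] by blast
  qed
  then show fr: "fractions (\<iota> ` R) = range \<iota>" by (simp add: R)
  show "separable_order (\<iota> ` R)"
  proof
    show "unital_subring (\<iota> ` R)"
    proof (rule unital_subringI)
      show "1 \<in> \<iota> ` R" using subring_one[OF R(1)] by (force intro: image_eqI[of _ _ 1])
      fix y z assume "y \<in> \<iota> ` R" "z \<in> \<iota> ` R"
      then obtain a b where ab: "y = \<iota> a" "z = \<iota> b" "a \<in> R" "b \<in> R" by blast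
      then have "y - z = \<iota> (a - b)" "y * z = \<iota> (a * b)" by (simp_all add: hom_distribs)
      with ab show "y - z \<in> \<iota> ` R" "y * z \<in> \<iota> ` R"
        using subring_diff[OF R(1)] subring_mult[OF R(1)] by blast+
    qed
    show "integral_closure (\<iota> ` R) \<inter> fractions (\<iota> ` R) \<subseteq> \<iota> ` R"
      unfolding fr using R(2) integral_closure_hom[OF \<iota>] by blast
    show "finite_over (fractions (\<iota> ` R))"
      unfolding fr using sep by (simp add: finite_separable_extension_def)
    fix x
    obtain p where p: "poly (map_poly \<iota> p) x = 0" "coprime p (pderiv p)"
      using sep unfolding finite_separable_extension_def by blast
    then have "poly (pderiv (map_poly \<iota> p)) x \<noteq> 0"
      using coprime_pderiv_simple_root[OF \<iota> p(2,1)] by (simp add: hom_distribs)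
    moreover have "map_poly \<iota> p \<in> polys_over (range \<iota>)" by (simp add: polys_over_def)
    ultimately show "\<exists>p\<in>polys_over (fractions (\<iota> ` R)). poly p x = 0 \<and> poly (pderiv p) x \<noteq> 0"
      unfolding fr using p(1) by blast
  qed
qed

subsection \<open>Hopf--Galois structures\<close>

text \<open>The well-definedness half of the universal property of the tensor product, checked on
  each generating relation.\<close>

lemma tensor_eq_sum_mset:
  fixes f :: "'a::ab_group_add \<Rightarrow> 'b::ab_group_add \<Rightarrow> 'c::ab_group_add"
  assumes addl: "\<And>a a' b. f (a + a') b = f a b + f a' b"
    and addr: "\<And>a b b'. f a (b + b') = f a b + f a b'"
    and bal: "\<And>c a b. f (sA c a) b = f a (sB c b)"
    and "tensor_eq sA sB s t"
  shows "(\<Sum>(a, b)\<in>#s. f a b) = (\<Sum>(a, b)\<in>#t. f a b)"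
proof -
  have zero: "f 0 b = 0" "f a 0 = 0" for a b
    using addl[of 0 0 b] addr[of a 0 0] by simp_all
  from assms(4) show ?thesis
    by (induction rule: tensor_eq.induct) (simp_all add: zero addl addr bal)
qed

lemma vector_space_ext_scale:
  assumes "field_hom \<iota>" shows "vector_space (ext_scale \<iota>)"
proof -
  interpret field_hom \<iota> by fact
  show ?thesis by standard (simp_all add: ext_scale_def algebra_simps hom_distribs)
qed

text \<open>Links the spans used for integrality to those of the vector space library.\<close>

lemma span_ext_scale:
  assumes "field_hom \<iota>" "finite S" "rspan (range \<iota>) S = UNIV"
  shows "module.span (ext_scale \<iota>) S = UNIV"
proof -
  interpret vector_space "ext_scale \<iota>" by (rule vector_space_ext_scale[OF assms(1)])
  have "x \<in> span S" for x
  proof -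
    obtain c where c: "\<forall>s\<in>S. c s \<in> range \<iota>" "x = (\<Sum>s\<in>S. c s * s)"
      using assms(3) unfolding rspan_def by blast
    have "c s * s \<in> span S" if "s \<in> S" for s
    proof -
      obtain k where "c s = \<iota> k" using c(1) \<open>s \<in> S\<close> by blast
      then show ?thesis using span_scale[OF span_base[OF \<open>s \<in> S\<close>], of k] by (simp add: ext_scale_def)
    qed
    then show ?thesis unfolding c(2) by (rule span_sum)
  qed
  then show ?thesis by blast
qed

lemma finite_dimensional_ext_scale:
  assumes "field_hom \<iota>" "finite_over (range \<iota>)"
  shows "\<exists>E. finite_dimensional_vector_space (ext_scale \<iota>) E"
proof -
  interpret vector_space "ext_scale \<iota>" by (rule vector_space_ext_scale[OF assms(1)])
  obtain S where S: "finite S" "span S = UNIV"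
    using assms span_ext_scale by (auto simp: finite_over_iff_rspan)
  obtain E where E: "independent E" "UNIV \<subseteq> span E"
    using basis_exists[of UNIV] by metis
  have "finite E" using independent_span_bound[OF S(1) E(1)] S(2) by simp
  with E have "finite_dimensional_vector_space (ext_scale \<iota>) E"
    by unfold_locales auto
  then show ?thesis by blast
qed

section \<open>The action, the Galois map and the orbit maps\<close>

context hopf_galois_structure
begin

lemma act_zero_left: "act 0 x = 0"
  using act_add_left[of 0 0 x] by (metis add_cancel_right_right add.right_neutral)

lemma act_add_right: "act h (x + y) = act h x + act h y"
  using act_linear[of h] by (simp add: Vector_Spaces.linear_iff)

lemma act_zero_right: "act h 0 = 0"
  using act_add_right[of h 0 0] by (metis add_cancel_right_right add.right_neutral)

lemma act_scale_right: "act h (\<iota> c * x) = \<iota> c * act h x"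
  using act_linear[of h] by (simp add: Vector_Spaces.linear_iff ext_scale_def)

lemma linear_orbit_map: "field_hom \<iota> \<Longrightarrow> Vector_Spaces.linear scale (ext_scale \<iota>) (\<lambda>h. act h x)"
  unfolding Vector_Spaces.linear_iff
  using vector_space_ext_scale vector_space_axioms
  by (auto simp only: act_add_left act_scale_left ext_scale_def)

lemma galois_map_cong:
  assumes "tensor_eq (ext_scale \<iota>) scale s t"
  shows "galois_map act s = galois_map act t"
proof
  fix y
  show "galois_map act s y = galois_map act t y"
    unfolding galois_map_def
  proof (rule tensor_eq_sum_mset[where f = "\<lambda>x h. x * act h y", OF _ _ _ assms])
    show "(a + a') * act b y = a * act b y + a' * act b y" for a a' b by (rule distrib_right)
    show "a * act (b + b') y = a * act b y + a * act b' y" for a b b'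
      unfolding act_add_left by (rule distrib_left)
    show "ext_scale \<iota> c a * act b y = a * act (scale c b) y" for c a b
      by (simp add: act_scale_left ext_scale_def)
  qed
qed

text \<open>As \<open>galois_map act\<close> is constant on classes, the induced map on the tensor
  product can be evaluated at any representative.\<close>

lemma the_elem_galois_map:
  "the_elem (galois_map act ` ({(s, t). tensor_eq (ext_scale \<iota>) scale s t} `` {s})) = galois_map act s"
proof (rule the_elem_image_unique)
  have "s \<in> {(s, t). tensor_eq (ext_scale \<iota>) scale s t} `` {s}" by (simp add: tensor_eq.refl)
  then show "{(s, t). tensor_eq (ext_scale \<iota>) scale s t} `` {s} \<noteq> {}" by (metis empty_iff)
  fix t assume "t \<in> {(s, t). tensor_eq (ext_scale \<iota>) scale s t} `` {s}"
  then have "tensor_eq (ext_scale \<iota>) scale s t" by simp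
  then show "galois_map act t = galois_map act s" by (rule galois_map_cong[symmetric])
qed

lemma galois_map_surj:
  assumes "Vector_Spaces.linear (ext_scale \<iota>) (ext_scale \<iota>) f"
  shows "\<exists>s. galois_map act s = f"
proof -
  have "f \<in> (\<lambda>T. the_elem (galois_map act ` T)) ` tensor_product (ext_scale \<iota>) scale"
    unfolding bij_betw_imp_surj_on[OF galois_bij] using assms by simp
  then obtain T where T: "T \<in> tensor_product (ext_scale \<iota>) scale"
    "f = the_elem (galois_map act ` T)" by blast
  then obtain s where s: "T = {(s, t). tensor_eq (ext_scale \<iota>) scale s t} `` {s}"
    unfolding tensor_product_def by (auto elim: quotientE)
  show ?thesis unfolding T(2) s the_elem_galois_map by blast
qed

lemma galois_map_inj:
  assumes "galois_map act s = galois_map act t"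
  shows "tensor_eq (ext_scale \<iota>) scale s t"
proof -
  let ?r = "{(s, t). tensor_eq (ext_scale \<iota>) scale s t}"
  have cls: "?r `` {u} \<in> tensor_product (ext_scale \<iota>) scale" for u
    unfolding tensor_product_def by (rule quotientI) simp
  have "the_elem (galois_map act ` (?r `` {s})) = the_elem (galois_map act ` (?r `` {t}))"
    using assms by (simp only: the_elem_galois_map)
  then have eq: "?r `` {s} = ?r `` {t}"
    by (rule inj_onD[OF bij_betw_imp_inj_on[OF galois_bij] _ cls cls])
  have "t \<in> ?r `` {s}" unfolding eq by (simp add: tensor_eq.refl)
  then show ?thesis by simp
qed

text \<open>If \<open>h\<close> acts as 0, injectivity of the Galois map makes the tensor of 1 and
  \<open>h\<close> zero. For nonzero \<open>h\<close>, a functional with \<phi>(h) = 1 induces the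
  balanced map sending (x, g) to x \<iota>(\<phi>(g)), whose value there is 1.\<close>

lemma act_faithful:
  assumes "field_hom \<iota>" and h: "\<And>x. act h x = 0"
  shows "h = 0"
proof (rule ccontr)
  interpret \<iota>: field_hom \<iota> by fact
  assume "h \<noteq> 0"
  interpret K: vector_space "(*) :: 'k \<Rightarrow> 'k \<Rightarrow> 'k" by standard (simp_all add: algebra_simps)
  interpret HK: vector_space_pair scale "(*) :: 'k \<Rightarrow> 'k \<Rightarrow> 'k" ..
  have "independent {h}" using \<open>h \<noteq> 0\<close> by simp
  then obtain \<phi> where \<phi>: "Vector_Spaces.linear scale (*) \<phi>" "\<phi> h = 1"
    using HK.linear_independent_extend[of "{h}" "\<lambda>_. 1"] by auto
  have "galois_map act {#(1, h)#} = galois_map act {#}"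
    by (rule ext) (simp add: galois_map_def h)
  then have "tensor_eq (ext_scale \<iota>) scale {#(1, h)#} {#}" by (rule galois_map_inj)
  then have "(\<Sum>(x, g)\<in>#{#(1, h)#}. x * \<iota> (\<phi> g)) = (\<Sum>(x, g)\<in>#{#}. x * \<iota> (\<phi> g))"
    using \<phi>(1) by (intro tensor_eq_sum_mset)
      (auto simp: Vector_Spaces.linear_iff ext_scale_def hom_distribs algebra_simps)
  then show False using \<phi>(2) by simp
qed

text \<open>This is [L:K] \<le> dim H. The coordinate functionals of a \<open>K\<close>-basis of
  \<open>L\<close> are independent over \<open>L\<close>, and surjectivity of the Galois map places
  them in the \<open>L\<close>-span of the actions of elements of \<open>\<beta>\<close>.\<close>

lemma card_basis_le:
  assumes \<iota>: "field_hom \<iota>" and E: "finite_dimensional_vector_space (ext_scale \<iota>) E"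
    and \<beta>: "finite \<beta>" "span \<beta> = UNIV"
  shows "card E \<le> card \<beta>"
proof -
  interpret \<iota>: field_hom \<iota> by fact
  interpret L: finite_dimensional_vector_space "ext_scale \<iota>" E by fact
  \<comment> \<open>Functions from \<open>L\<close> to \<open>L\<close> form a vector space over
    \<open>L\<close>, scalars multiplying the values.\<close>
  interpret F: vector_space "\<lambda>(c :: 'l) f (y :: 'l). c * f y"
    by standard (simp_all add: fun_eq_iff algebra_simps)
  have sum_apply: "(\<Sum>i\<in>I. f i) y = (\<Sum>i\<in>I. f i y)" for I and f :: "'i \<Rightarrow> 'l \<Rightarrow> 'l" and y
    by (induction I rule: infinite_finite_induct) simp_all
  define \<pi> where "\<pi> e y = \<iota> (L.representation E y e)" for e y
  have \<pi>: "\<pi> e e' = (if e = e' then 1 else 0)" if "e \<in> E" "e' \<in> E" for e e'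
    using that L.representation_basis[OF L.independent_Basis] by (auto simp: \<pi>_def)
  have inj: "inj_on \<pi> E"
    by (rule inj_onI) (metis \<pi> zero_neq_one)
  have "F.independent (\<pi> ` E)"
  proof (rule F.independent_if_scalars_zero)
    fix c f assume zero: "(\<Sum>g\<in>\<pi> ` E. (\<lambda>y. c g * g y)) = 0" and "f \<in> \<pi> ` E"
    then obtain e where e: "e \<in> E" "f = \<pi> e" by blast
    \<comment> \<open>Evaluation at the basis vector \<open>e\<close> isolates the coefficient of
      \<open>\<pi> e\<close>.\<close>
    have "0 = (\<Sum>g\<in>\<pi> ` E. (\<lambda>y. c g * g y)) e" using zero by simp
    also have "\<dots> = (\<Sum>e'\<in>E. c (\<pi> e') * \<pi> e' e)" by (simp add: sum_apply sum.reindex[OF inj])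
    also have "\<dots> = (\<Sum>e'\<in>E. if e' = e then c (\<pi> e) else 0)"
      using e by (intro sum.cong) (auto simp: \<pi>)
    also have "\<dots> = c f" using e L.finite_Basis by simp
    finally show "c f = 0" by simp
  qed (simp add: L.finite_Basis)
  moreover have "\<pi> ` E \<subseteq> F.span (act ` \<beta>)"
  proof safe
    fix e assume "e \<in> E"
    have "Vector_Spaces.linear (ext_scale \<iota>) (ext_scale \<iota>) (\<pi> e)"
    proof (intro Vector_Spaces.linear_iff[THEN iffD2] conjI allI)
      have span: "y \<in> L.span E" for y by (simp add: L.span_Basis)
      fix c y z
      show "\<pi> e (y + z) = \<pi> e y + \<pi> e z"
        unfolding \<pi>_def L.representation_add[OF L.independent_Basis span span] by (rule \<iota>.hom_add)
      show "\<pi> e (ext_scale \<iota> c y) = ext_scale \<iota> c (\<pi> e y)"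
        unfolding \<pi>_def L.representation_scale[OF L.independent_Basis span]
        by (simp only: ext_scale_def \<iota>.hom_mult)
    qed (rule L.vector_space_axioms)+
    then obtain s where s: "galois_map act s = \<pi> e" using galois_map_surj by blast
    have "act 0 = 0" and "act (g + h) = act g + act h"
      and "act (scale c h) = (\<lambda>y. \<iota> c * act h y)" for c g h
      by (rule ext; simp add: act_zero_left act_add_left act_scale_left)+
    then have "subspace {h. act h \<in> F.span (act ` \<beta>)}"
      by (intro subspaceI) (simp_all add: F.span_zero F.span_add F.span_scale)
    moreover have "\<beta> \<subseteq> {h. act h \<in> F.span (act ` \<beta>)}"
      by (auto intro: F.span_base)
    ultimately have "span \<beta> \<subseteq> {h. act h \<in> F.span (act ` \<beta>)}" by (rule span_minimal[rotated])
    then have act: "act h \<in> F.span (act ` \<beta>)" for h using \<beta>(2) by blast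
    have "galois_map act s \<in> F.span (act ` \<beta>)"
    proof (induction s)
      case empty
      have "galois_map act {#} = 0" by (rule ext) (simp add: galois_map_def)
      then show ?case by (simp only: F.span_zero)
    next
      case (add p s)
      obtain x h where p: "p = (x, h)" by fastforce
      have "galois_map act (add_mset p s) = (\<lambda>y. x * act h y) + galois_map act s"
        by (rule ext) (simp add: galois_map_def p)
      then show ?case using F.span_add[OF F.span_scale[OF act] add] by (simp only:)
    qed
    then show "\<pi> e \<in> F.span (act ` \<beta>)" using s by simp
  qed
  ultimately have "card (\<pi> ` E) \<le> card (act ` \<beta>)"
    using F.independent_span_bound[of "act ` \<beta>" "\<pi> ` E"] \<beta>(1) by simp
  then show ?thesis using card_image[OF inj] card_image_le[OF \<beta>(1), of act] by simp
qed

text \<open>Surjectivity of the Galois map bounds the dimension of the Hopf algebra from below by the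
  degree of the extension, injectivity of the orbit map from above.\<close>

lemma orbit_map_surj:
  assumes \<iota>: "field_hom \<iota>" and fin: "finite_over (range \<iota>)"
    and inj: "\<And>h. act h x = 0 \<Longrightarrow> h = 0"
  shows "\<exists>h. act h x = y"
proof -
  obtain E where E: "finite_dimensional_vector_space (ext_scale \<iota>) E"
    using finite_dimensional_ext_scale[OF \<iota> fin] by blast
  interpret L: finite_dimensional_vector_space "ext_scale \<iota>" E by fact
  interpret HL: vector_space_pair scale "ext_scale \<iota>" ..
  let ?f = "\<lambda>h. act h x"
  have lin: "Vector_Spaces.linear scale (ext_scale \<iota>) ?f" by (rule linear_orbit_map[OF \<iota>])
  have inj: "inj ?f" using inj HL.linear_inj_iff_eq_0[OF lin] by blast
  obtain \<beta> where \<beta>: "independent \<beta>" "UNIV \<subseteq> span \<beta>" using basis_exists[of UNIV] by metis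
  then have span: "span \<beta> = UNIV" by blast
  have ind: "L.independent (?f ` \<beta>)"
    using HL.linear_independent_injective_image[OF lin \<beta>(1)] inj by (metis inj_on_subset subset_UNIV)
  then have "finite (?f ` \<beta>)" by (rule L.finiteI_independent)
  then have "finite \<beta>" using inj by (metis finite_imageD inj_on_subset subset_UNIV)
  then have "card E \<le> card (?f ` \<beta>)"
    using card_basis_le[OF \<iota> E _ span] inj card_image by (metis inj_on_subset subset_UNIV)
  \<comment> \<open>An independent set with at least [L:K] members spans \<open>L\<close>.\<close>
  then have "L.dim UNIV \<le> card (?f ` \<beta>)" by (simp add: L.dim_UNIV L.dimension_def)
  then have "UNIV \<subseteq> L.span (?f ` \<beta>)" by (intro L.card_ge_dim_independent ind) auto
  also have "\<dots> = ?f ` span \<beta>" by (rule HL.linear_span_image[OF lin])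
  finally have "y \<in> ?f ` span \<beta>" by (rule subsetD) simp
  then show ?thesis by auto
qed

end

section \<open>Transfer of freeness between commuting structures\<close>

text \<open>One direction of the equivalence; exchanging the two structures gives the other.\<close>

lemma free_module_transfer:
  fixes \<iota> :: "'k::field \<Rightarrow> 'l::field"
    and scale1 :: "'k \<Rightarrow> 'h1::ring_1 \<Rightarrow> 'h1"
    and scale2 :: "'k \<Rightarrow> 'h2::ring_1 \<Rightarrow> 'h2"
  assumes S1: "hopf_galois_structure \<iota> scale1 comult1 counit1 antipode1 act1"
    and S2: "hopf_galois_structure \<iota> scale2 comult2 counit2 antipode2 act2"
    and commute: "\<And>h1 h2 x. act1 h1 (act2 h2 x) = act2 h2 (act1 h1 x)"
    and \<iota>: "field_hom \<iota>" and fin: "finite_over (range \<iota>)"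
    and A: "separable_order (\<iota> ` R)" "fractions (\<iota> ` R) = range \<iota>"
    and B: "fractional_ideal (integral_closure (\<iota> ` R)) B"
    and free: "free_module (associated_order act1 B) act1 B"
  shows "free_module (associated_order act2 B) act2 B"
proof -
  interpret \<iota>: field_hom \<iota> by fact
  interpret A: separable_order "\<iota> ` R" by fact
  interpret S1: hopf_galois_structure \<iota> scale1 comult1 counit1 antipode1 act1 by fact
  interpret S2: hopf_galois_structure \<iota> scale2 comult2 counit2 antipode2 act2 by fact
  let ?A1 = "associated_order act1 B" and ?A2 = "associated_order act2 B"
  have B0: "0 \<in> B" and "B \<noteq> {0}" using B by (simp_all add: fractional_ideal_def)
  then obtain b0 where b0: "b0 \<in> B" "b0 \<noteq> 0" by blast
  have B_mult: "\<iota> r * b \<in> B" if "r \<in> R" "b \<in> B" for r b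
  proof -
    have "\<iota> r \<in> integral_closure (\<iota> ` R)" using that(1) A.order_subset by blast
    then show ?thesis using that(2) B by (simp add: fractional_ideal_def)
  qed
  have zero_A1: "0 \<in> ?A1" and zero_A2: "0 \<in> ?A2"
    by (simp_all add: associated_order_def S1.act_zero_left S2.act_zero_left B0)
  \<comment> \<open>The action of \<open>h\<close> is \<open>K\<close>-linear, so
    \<open>linear_map_denominator\<close> supplies a nonzero \<open>r\<close> in \<open>R\<close>
    that clears its denominators on \<open>B\<close>.\<close>
  have denominator: "\<exists>r\<in>R. r \<noteq> 0 \<and> scale1 r h \<in> ?A1" for h
  proof -
    have "\<exists>d\<in>\<iota> ` R. d \<noteq> 0 \<and> (\<forall>b\<in>B. d * act1 h b \<in> B)"
      by (rule A.linear_map_denominator[OF B])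
        (auto simp: A(2) S1.act_add_right S1.act_scale_right)
    then obtain r where "r \<in> R" "\<iota> r \<noteq> 0" "\<forall>b\<in>B. \<iota> r * act1 h b \<in> B" by blast
    then show ?thesis by (intro bexI[of _ r]) (auto simp: associated_order_def S1.act_scale_left)
  qed
  \<comment> \<open>Names the condition under the unique existence in \<open>free_module\<close>, so
    that uniqueness can be applied to explicit families.\<close>
  define combination where "combination Y b c \<longleftrightarrow> range c \<subseteq> ?A1 \<and> (\<forall>x. x \<notin> Y \<longrightarrow> c x = 0) \<and>
      finite {x. c x \<noteq> 0} \<and> b = (\<Sum>x | c x \<noteq> 0. act1 (c x) x)" for Y b c
  have "\<exists>Y\<subseteq>B. \<forall>b\<in>B. \<exists>!c. combination Y b c"
    using free unfolding free_module_def combination_def .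
  then obtain Y where basis: "Y \<subseteq> B \<and> (\<forall>b\<in>B. \<exists>!c. combination Y b c)" by (rule exE)
  then have "Y \<subseteq> B" by (rule conjunct1)
  have Y: "\<exists>!c. combination Y b c" if "b \<in> B" for b
    using conjunct2[OF basis] that by (rule bspec)
  define single where "single z g = (\<lambda>x. if x = z then g else 0)" for z :: 'l and g :: 'h1
  have single: "combination Y (act1 g z) (single z g)"
    if "z \<in> Y" "g \<in> ?A1" for z g
  proof (cases "g = 0")
    case True
    then show ?thesis
      using zero_A1 by (auto simp: combination_def single_def S1.act_zero_left)
  next
    case False
    then have "{x. single z g x \<noteq> 0} = {z}" by (auto simp: single_def)
    then show ?thesis using that zero_A1 by (auto simp: combination_def single_def)
  qed
  \<comment> \<open>Two one-term combinations with the same value in \<open>B\<close> coincide by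
    uniqueness.\<close>
  have single_inj: "single y g = single z h"
    if "y \<in> Y" "z \<in> Y" "g \<in> ?A1" "h \<in> ?A1" "act1 g y = act1 h z" for y z g h
  proof -
    have "act1 g y \<in> B" using that \<open>Y \<subseteq> B\<close> by (auto simp: associated_order_def)
    from Y[OF this] obtain c where "\<And>c'. combination Y (act1 g y) c' \<Longrightarrow> c' = c" by blast
    from this[OF single[OF that(1,3)]] this[OF single[OF that(2,4), folded that(5)]]
    show ?thesis by simp
  qed
  \<comment> \<open>A nonzero multiple of \<open>h\<close> in the order also kills \<open>x\<close>,
    so its one-term combination equals that of 0.\<close>
  have orbit_inj: "h = 0" if x: "x \<in> Y" and h: "act1 h x = 0" for x h
  proof -
    obtain r where r: "r \<in> R" "r \<noteq> 0" "scale1 r h \<in> ?A1" using denominator by blast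
    have "act1 (scale1 r h) x = act1 0 x" by (simp add: S1.act_scale_left S1.act_zero_left h)
    from fun_cong[OF single_inj[OF x x r(3) zero_A1 this], of x] r(2)
    show ?thesis by (simp add: single_def)
  qed
  have orbit_surj: "\<exists>h. act1 h x = y" if "x \<in> Y" for x y
    using S1.orbit_map_surj[OF \<iota> fin] orbit_inj[OF that] by blast
  have "Y \<noteq> {}"
  proof
    assume "Y = {}"
    obtain c where c: "combination Y b0 c" using Y[OF b0(1)] by blast
    then have "c y = 0" for y using \<open>Y = {}\<close> by (simp add: combination_def)
    then show False using c b0(2) by (simp add: combination_def)
  qed
  then obtain x where x: "x \<in> Y" by blast
  \<comment> \<open>A second basis vector y = h x would give r y two expressions, with coefficient r
    at \<open>y\<close> and with coefficient r h at \<open>x\<close>.\<close>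
  have "y = x" if y: "y \<in> Y" for y
  proof (rule ccontr)
    assume "y \<noteq> x"
    obtain h where h: "act1 h x = y" using orbit_surj[OF x] by blast
    obtain r where r: "r \<in> R" "r \<noteq> 0" "scale1 r h \<in> ?A1" using denominator by blast
    have "scale1 r 1 \<in> ?A1"
      using B_mult[OF r(1)] by (simp add: associated_order_def S1.act_scale_left S1.act_one)
    moreover have "act1 (scale1 r 1) y = act1 (scale1 r h) x"
      by (simp add: S1.act_scale_left S1.act_one h)
    ultimately have "single y (scale1 r 1) = single x (scale1 r h)"
      using single_inj[OF y x _ r(3)] by blast
    from fun_cong[OF this, of y] \<open>y \<noteq> x\<close> r(2) show False by (simp add: single_def)
  qed
  then have Y_eq: "Y = {x}" using x by blast
  have generates: "\<exists>g\<in>?A1. b = act1 g x" if "b \<in> B" for b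
  proof -
    obtain c where "combination Y b c" using Y[OF \<open>b \<in> B\<close>] by blast
    then have c: "range c \<subseteq> ?A1" "\<forall>y. y \<notin> Y \<longrightarrow> c y = 0"
      "b = (\<Sum>y | c y \<noteq> 0. act1 (c y) y)" by (simp_all add: combination_def)
    have "{y. c y \<noteq> 0} = (if c x = 0 then {} else {x})" using c(2) Y_eq by auto
    then have "b = act1 (c x) x" using c(3) by (simp add: S1.act_zero_left split: if_splits)
    then show ?thesis using c(1) by blast
  qed
  \<comment> \<open>\<open>h\<close> commutes with the first action, so it kills the whole orbit of
    \<open>x\<close>, which is \<open>L\<close>.\<close>
  have inj2: "h = 0" if h: "act2 h x = 0" for h
  proof (rule S2.act_faithful[OF \<iota>])
    fix y
    obtain g where "act1 g x = y" using orbit_surj[OF x] by blast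
    then show "act2 h y = 0" using commute[of g h x] h by (simp add: S1.act_zero_right)
  qed
  have basis2: "\<exists>!c. range c \<subseteq> ?A2 \<and> (\<forall>y. y \<notin> {x} \<longrightarrow> c y = 0) \<and> finite {y. c y \<noteq> 0} \<and>
      b = (\<Sum>y | c y \<noteq> 0. act2 (c y) y)" if b: "b \<in> B" for b
  proof -
    obtain h where h: "act2 h x = b" using S2.orbit_map_surj[OF \<iota> fin inj2] by blast
    \<comment> \<open>Write b' = g x with g in the first order. Then h b' = g (h x) = g b, which
      lies in \<open>B\<close>.\<close>
    have hA: "h \<in> ?A2"
      unfolding associated_order_def
    proof (intro CollectI ballI)
      fix b' assume "b' \<in> B"
      then obtain g where g: "g \<in> ?A1" "b' = act1 g x" using generates by blast
      then have "act2 h b' = act1 g b" using commute[of g h x] h by simp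
      then show "act2 h b' \<in> B" using g(1) b by (simp add: associated_order_def)
    qed
    have sum: "(\<Sum>y | c y \<noteq> 0. act2 (c y) y) = act2 (c x) x" if "\<forall>y. y \<notin> {x} \<longrightarrow> c y = 0" for c
    proof -
      have "{y. c y \<noteq> 0} = (if c x = 0 then {} else {x})" using that by auto
      then show ?thesis by (simp add: S2.act_zero_left)
    qed
    show ?thesis
    proof (rule ex1I[of _ "\<lambda>y. if y = x then h else 0"], intro conjI)
      let ?c = "\<lambda>y. if y = x then h else 0"
      show "range ?c \<subseteq> ?A2" using hA zero_A2 by auto
      show supp: "\<forall>y. y \<notin> {x} \<longrightarrow> ?c y = 0" by simp
      have "{y. ?c y \<noteq> 0} \<subseteq> {x}" by auto
      then show "finite {y. ?c y \<noteq> 0}" by (rule finite_subset) simp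
      show "b = (\<Sum>y | ?c y \<noteq> 0. act2 (?c y) y)" unfolding sum[OF supp] by (simp add: h)
    next
      fix c
      assume c: "range c \<subseteq> ?A2 \<and> (\<forall>y. y \<notin> {x} \<longrightarrow> c y = 0) \<and> finite {y. c y \<noteq> 0} \<and>
          b = (\<Sum>y | c y \<noteq> 0. act2 (c y) y)"
      then have "act2 (c x) x = b" using sum[of c] by metis
      then have "act2 (c x) x = act2 h x" using h by simp
      then have "act2 (c x - h) x = 0" using S2.act_add_left[of "c x - h" h x] by simp
      then have "c x = h" using inj2 by force
      moreover have "c y = 0" if "y \<noteq> x" for y using c that by blast
      ultimately show "c = (\<lambda>y. if y = x then h else 0)" by (intro ext) simp
    qed
  qed
  show ?thesis
    unfolding free_module_def
  proof (intro exI[of _ "{x}"] conjI ballI)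
    show "{x} \<subseteq> B" using x \<open>Y \<subseteq> B\<close> by blast
  qed (rule basis2)
qed

text \<open>The ring of integers of \<open>L\<close> enters as the integral closure of the image of
  \<open>OK\<close>.\<close>

theorem theorem1p2:
  fixes \<iota> :: "'k::field \<Rightarrow> 'l::field"
    and OK :: "'k set"
    and scale1 :: "'k \<Rightarrow> 'h1::ring_1 \<Rightarrow> 'h1"
    and scale2 :: "'k \<Rightarrow> 'h2::ring_1 \<Rightarrow> 'h2"
    and act1 :: "'h1 \<Rightarrow> 'l \<Rightarrow> 'l"
    and act2 :: "'h2 \<Rightarrow> 'l \<Rightarrow> 'l"
    and B :: "'l set"
  assumes "ring_of_integers OK"
    and "finite_separable_extension \<iota>"
    and "hopf_galois_structure \<iota> scale1 comult1 counit1 antipode1 act1"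
    and "hopf_galois_structure \<iota> scale2 comult2 counit2 antipode2 act2"
    and "\<And>h1 h2 x. act1 h1 (act2 h2 x) = act2 h2 (act1 h1 x)"
    and "fractional_ideal (integral_closure (\<iota> ` OK)) B"
  shows "free_module (associated_order act1 B) act1 B \<longleftrightarrow>
         free_module (associated_order act2 B) act2 B"
proof -
  have "field_hom \<iota>" "finite_over (range \<iota>)"
    using assms(2) by (simp_all add: finite_separable_extension_def)
  note base = this separable_order_image[OF assms(1,2)] assms(6)
  show ?thesis
    using free_module_transfer[OF assms(3,4,5) base]
      free_module_transfer[OF assms(4,3) assms(5)[symmetric] base] by blast
qed

end
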